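(* There is an efficient randomized algorithm that, given any positive integers $D,k,n$ with $k\leq n$, and a $(k,D)$-connected $n$-vertex graph $G$, computes a collection $\mathcal{T}=\{T_1,\ldots,T_k\}$ of $k$ spanning trees of $G$, such that, for each $1\leq\ell\leq k$, tree $T_\ell$ has diameter at most $O(D\log n)$, and, with probability at least $1-1/\mathrm{poly}(n)$, each edge of $G$ appears in $O(\log n)$ trees of $\mathcal{T}$.
   Context: Graphs are finite, undirected, unweighted, without loops; parallel edges are allowed. A graph $G$ is $(k,D)$-connected if for every pair $u,v\in V(G)$ of distinct vertices there are $k$ edge-disjoint paths in $G$ connecting $u$ to $v$, each of length (number of edges) at most $D$. "Efficient" means running time polynomial in the input size. *)

theory Defs
  imports
    "HOL-Probability.Probability"
    "HOL-Computational_Algebra.Polynomial"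
    "HOL-Library.Log_Nat"
begin

section \<open>Multigraphs\<close>

record ('v, 'e) multigraph =
  verts :: "'v set"
  edges :: "'e set"
  ends :: "'e \<Rightarrow> 'v set"

text \<open>Finite, loopless, parallel edges allowed.\<close>

definition wf_multigraph :: "('v, 'e) multigraph \<Rightarrow> bool" where
  "wf_multigraph G \<longleftrightarrow> finite (verts G) \<and> finite (edges G) \<and>
     (\<forall>e\<in>edges G. ends G e \<subseteq> verts G \<and> card (ends G e) = 2)"

text \<open>A walk is given by its vertex sequence together with its edge sequence, since the
  vertices alone do not determine which of several parallel edges is used.\<close>

definition is_walk :: "('v, 'e) multigraph \<Rightarrow> 'v list \<Rightarrow> 'e list \<Rightarrow> bool" where
  "is_walk G vs es \<longleftrightarrow> length vs = Suc (length es) \<and> set vs \<subseteq> verts G \<and> set es \<subseteq> edges G \<and>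
     (\<forall>i<length es. ends G (es ! i) = {vs ! i, vs ! Suc i})"

definition is_path :: "('v, 'e) multigraph \<Rightarrow> 'v \<Rightarrow> 'v list \<Rightarrow> 'e list \<Rightarrow> 'v \<Rightarrow> bool" where
  "is_path G u vs es v \<longleftrightarrow> is_walk G vs es \<and> distinct vs \<and> hd vs = u \<and> last vs = v"

text \<open>Two parallel edges form a cycle of length 2; distinctness of the edges excludes
  traversing one edge back and forth.\<close>

definition is_cycle :: "('v, 'e) multigraph \<Rightarrow> 'v list \<Rightarrow> 'e list \<Rightarrow> bool" where
  "is_cycle G vs es \<longleftrightarrow> is_walk G vs es \<and> es \<noteq> [] \<and> hd vs = last vs \<and>
     distinct (tl vs) \<and> distinct es"

definition graph_connected :: "('v, 'e) multigraph \<Rightarrow> bool" where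
  "graph_connected G \<longleftrightarrow> verts G \<noteq> {} \<and>
     (\<forall>u\<in>verts G. \<forall>v\<in>verts G. \<exists>vs es. is_path G u vs es v)"

definition is_tree :: "('v, 'e) multigraph \<Rightarrow> bool" where
  "is_tree G \<longleftrightarrow> graph_connected G \<and> (\<nexists>vs es. is_cycle G vs es)"

definition spanning_subgraph :: "('v, 'e) multigraph \<Rightarrow> 'e set \<Rightarrow> ('v, 'e) multigraph" where
  "spanning_subgraph G F = G\<lparr>edges := F\<rparr>"

definition is_spanning_tree :: "('v, 'e) multigraph \<Rightarrow> 'e set \<Rightarrow> bool" where
  "is_spanning_tree G F \<longleftrightarrow> F \<subseteq> edges G \<and> is_tree (spanning_subgraph G F)"

text \<open>Distance and diameter are only meaningful for finite, nonempty, connected graphs.\<close>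

definition graph_dist :: "('v, 'e) multigraph \<Rightarrow> 'v \<Rightarrow> 'v \<Rightarrow> nat" where
  "graph_dist G u v = (LEAST d. \<exists>vs es. is_path G u vs es v \<and> length es = d)"

definition graph_diameter :: "('v, 'e) multigraph \<Rightarrow> nat" where
  "graph_diameter G = Max {graph_dist G u v | u v. u \<in> verts G \<and> v \<in> verts G}"

definition kD_connected :: "('v, 'e) multigraph \<Rightarrow> nat \<Rightarrow> nat \<Rightarrow> bool" where
  "kD_connected G k D \<longleftrightarrow>
     (\<forall>u\<in>verts G. \<forall>v\<in>verts G. u \<noteq> v \<longrightarrow>
        (\<exists>vs es. (\<forall>i<k. is_path G u (vs i) (es i) v \<and> length (es i) \<le> D) \<and>
                 (\<forall>i<k. \<forall>j<k. i \<noteq> j \<longrightarrow> set (es i) \<inter> set (es j) = {})))"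


section \<open>Randomized random-access programs\<close>

text \<open>Structured programs for a random-access machine over the natural numbers with finitely
  many unbounded arrays (a scalar is cell 0 of an array) and fair coin flips. Every assignment,
  coin flip and control step has unit cost. A fixed program contains only finitely many
  expressions, and these offer addition and truncated subtraction but no multiplication, so a
  step increases the maximal bit length of the stored numbers by at most a constant. Hence
  polynomially many steps correspond to polynomial time on a (probabilistic) Turing machine.\<close>

datatype expr =
    Const nat
  | Cell nat expr
  | Add expr expr
  | Sub expr expr
  | Less expr expr

datatype prog =
    Skip
  | Assign nat expr expr
  | Flip nat expr
  | Seq prog prog
  | Cond expr prog prog
  | While expr prog

type_synonym memory = "nat \<Rightarrow> nat \<Rightarrow> nat"

primrec eval_expr :: "expr \<Rightarrow> memory \<Rightarrow> nat" where
  "eval_expr (Const c) s = c"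
| "eval_expr (Cell a i) s = s a (eval_expr i s)"
| "eval_expr (Add e f) s = eval_expr e s + eval_expr f s"
| "eval_expr (Sub e f) s = eval_expr e s - eval_expr f s"
| "eval_expr (Less e f) s = of_bool (eval_expr e s < eval_expr f s)"

definition store :: "memory \<Rightarrow> nat \<Rightarrow> nat \<Rightarrow> nat \<Rightarrow> memory" where
  "store s a i x = s(a := (s a)(i := x))"

text \<open>Small-step semantics; a test succeeds iff its value is nonzero, and
  \<^term>\<open>Skip\<close> is the halted program.\<close>

primrec step :: "prog \<Rightarrow> memory \<Rightarrow> (prog \<times> memory) pmf" where
  "step Skip s = return_pmf (Skip, s)"
| "step (Assign a i e) s = return_pmf (Skip, store s a (eval_expr i s) (eval_expr e s))"
| "step (Flip a i) s =
     map_pmf (\<lambda>b. (Skip, store s a (eval_expr i s) (of_bool b))) (bernoulli_pmf (1/2))"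
| "step (Seq P Q) s =
     (if P = Skip then return_pmf (Q, s) else map_pmf (\<lambda>(P', s'). (Seq P' Q, s')) (step P s))"
| "step (Cond e P Q) s = return_pmf (if eval_expr e s \<noteq> 0 then P else Q, s)"
| "step (While e P) s =
     return_pmf (if eval_expr e s \<noteq> 0 then Seq P (While e P) else Skip, s)"

text \<open>Distribution of the configuration after a given number of steps.\<close>

primrec run :: "nat \<Rightarrow> prog \<times> memory \<Rightarrow> (prog \<times> memory) pmf" where
  "run 0 x = return_pmf x"
| "run (Suc t) x = bind_pmf (case_prod step x) (run t)"


section \<open>Input and output conventions\<close>

text \<open>An \<open>n\<close>-vertex multigraph is presented as a list of edges over the vertices
  \<open>0, \<dots>, n - 1\<close>; the edges are identified with the positions in this list.\<close>

definition valid_edge_list :: "nat \<Rightarrow> (nat \<times> nat) list \<Rightarrow> bool" where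
  "valid_edge_list n es \<longleftrightarrow> (\<forall>(u, v)\<in>set es. u < n \<and> v < n \<and> u \<noteq> v)"

definition graph_of :: "nat \<Rightarrow> (nat \<times> nat) list \<Rightarrow> (nat, nat) multigraph" where
  "graph_of n es = \<lparr>verts = {..<n}, edges = {..<length es},
     ends = (\<lambda>e. {fst (es ! e), snd (es ! e)})\<rparr>"

lemma wf_graph_of:
  assumes "valid_edge_list n es"
  shows "wf_multigraph (graph_of n es)"
proof -
  have "fst (es ! e) < n \<and> snd (es ! e) < n \<and> fst (es ! e) \<noteq> snd (es ! e)" if "e < length es" for e
    using assms nth_mem[OF that] unfolding valid_edge_list_def by (auto simp: case_prod_beta)
  then show ?thesis
    unfolding wf_multigraph_def graph_of_def by auto
qed

definition encode_input :: "nat \<Rightarrow> nat \<Rightarrow> nat \<Rightarrow> (nat \<times> nat) list \<Rightarrow> nat list" where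
  "encode_input D k n es = [D, k, n, length es] @ concat (map (\<lambda>(u, v). [u, v]) es)"

text \<open>Total number of binary digits, plus one separator per number.\<close>

definition input_size :: "nat list \<Rightarrow> nat" where
  "input_size xs = (\<Sum>x\<leftarrow>xs. floorlog 2 x + 1)"

definition initial_memory :: "nat list \<Rightarrow> memory" where
  "initial_memory xs = (\<lambda>a i. if a = 0 \<and> i < length xs then xs ! i else 0)"

text \<open>The output is read off array 1 as a \<open>k \<times> m\<close> incidence matrix, stored row by
  row: row \<open>l\<close> marks the edges of the \<open>l\<close>-th tree, where \<open>m\<close> is the number of edges.\<close>

definition output_tree :: "nat \<Rightarrow> memory \<Rightarrow> nat \<Rightarrow> nat set" where
  "output_tree m s l = {e. e < m \<and> s 1 (l * m + e) \<noteq> 0}"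

end

theory Submission imports Defs
begin

text \<open>The algorithm is deterministic and uses multiplicative weights. The trees are built one after
  another, and an edge that has been used \<open>i\<close> times so far has weight \<open>2 ^ i\<close>. Let \<open>W\<close> be the
  current total weight. To build a tree, start with all vertices as cluster centers and repeatedly
  link two centers by a lightest walk with at most \<open>2 D\<close> edges, letting the larger of the two
  clusters absorb the smaller one. If \<open>s\<close> centers are left and any two are at distance at least
  \<open>\<theta>\<close>, then the balls of radius \<open>\<theta> / 2\<close> (restricted to \<open>D\<close> edges) around them are disjoint,
  and each contains initial segments, of weight \<open>\<theta> / 2\<close>, of \<open>k\<close> edge-disjoint paths; hence
  \<open>s * k * \<theta> \<le> 4 * W\<close>. Summing over \<open>s\<close>, the linked subgraph has weight at most
  \<open>4 * W * ln n / k\<close>, and every vertex is at distance at most \<open>2 * D * log 2 n\<close> from the last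
  center, because each absorption at least doubles the size of its cluster. A breadth-first search
  tree of this subgraph is output and all edges of the subgraph count as used. After \<open>k\<close> rounds
  the total weight has grown by a factor of at most \<open>(1 + 4 * ln n / k) ^ k \<le> n ^ 4\<close>. As it suffices to
  work with \<open>k\<close> edges from each parallel class, it is at most \<open>n ^ 3\<close> initially, so no edge is
  used more than \<open>7 * log 2 n\<close> times.\<close>

section \<open>Total correctness with step counts\<close>

text \<open>The cost of a tree is bounded relative to \<open>W\<close>, by a fraction that does not
  depend on how the weights are distributed. So \<open>k\<close> rounds of doubling raise the total
  only by a factor polynomial in \<open>n\<close>, while a single edge of load \<open>i\<close>
  alone weighs at least \<open>2 ^ i\<close>.

  The obstacle is that a tree must be light and shallow at once: a walk of least weight can have
  many edges. Distances are therefore taken among walks with a bounded number of edges, and the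
  bound \<open>2 * D\<close> is what joining two balls of \<open>D\<close> edges needs. The linked
  subgraph may contain cycles because its walks can overlap. The breadth-first tree ignores weights
  and only exploits that all vertices are few edges away from the last center; its edges are charged
  through the subgraph containing it.

  Polynomial time needs two further bounds, since \<open>D\<close> and \<open>n\<close> are given in
  binary: \<open>D\<close> is capped at \<open>n\<close>, and \<open>n\<close> is bounded by the
  number of edges. No coin is flipped, so the congestion bound holds with probability one.\<close>

inductive steps :: "nat \<Rightarrow> prog \<times> memory \<Rightarrow> prog \<times> memory \<Rightarrow> bool" where
  steps_0: "steps 0 x x"
| steps_Suc: "P \<noteq> Skip \<Longrightarrow> step P s = return_pmf y \<Longrightarrow> steps t y z \<Longrightarrow> steps (Suc t) (P, s) z"

lemma steps_1: "P \<noteq> Skip \<Longrightarrow> step P s = return_pmf y \<Longrightarrow> steps 1 (P, s) y"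
  using steps_Suc[OF _ _ steps_0] by simp

lemma steps_trans: "steps t x y \<Longrightarrow> steps t' y z \<Longrightarrow> steps (t + t') x z"
proof (induction rule: steps.induct)
  case (steps_Suc P s y t z)
  then show ?case using steps.steps_Suc[of P s y "t + t'" z] steps.steps_Suc by simp
qed simp

text \<open>A step of \<open>P\<close> lifts to \<open>Seq P Q\<close> only while \<open>P\<close>
  is not \<open>Skip\<close>; this is why \<open>steps\<close> excludes steps of a halted
  program.\<close>

lemma steps_Seq: "steps t x y \<Longrightarrow> steps t (Seq (fst x) Q, snd x) (Seq (fst y) Q, snd y)"
proof (induction rule: steps.induct)
  case (steps_Suc P s y t z)
  then have "step (Seq P Q) s = return_pmf (Seq (fst y) Q, snd y)"
    by (simp add: case_prod_beta)
  then show ?case using steps_Suc by (auto intro: steps.steps_Suc)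
qed (rule steps_0)

lemma steps_run: "steps t x y \<Longrightarrow> run t x = return_pmf y"
  by (induction rule: steps.induct) (auto simp: bind_return_pmf)

lemma run_Skip: "run t (Skip, s) = return_pmf (Skip, s)"
  by (induction t) (auto simp: bind_return_pmf)

lemma run_add: "run (t + t') x = bind_pmf (run t x) (run t')"
  by (induction t arbitrary: x)
    (simp_all add: bind_return_pmf bind_assoc_pmf cong: bind_pmf_cong)

text \<open>A halted configuration is a fixed point, so an upper bound on the halting time serves as
  well as its exact value.\<close>

lemma steps_run_ge:
  assumes "steps t x (Skip, s)" "t \<le> t'"
  shows "run t' x = return_pmf (Skip, s)"
proof -
  obtain d where "t' = t + d" using assms(2) le_Suc_ex by blast
  then show ?thesis by (simp add: run_add steps_run[OF assms(1)] bind_return_pmf run_Skip)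
qed

section \<open>Costs, frames and weakest preconditions\<close>

primrec mods :: "prog \<Rightarrow> nat set" where
  "mods Skip = {}"
| "mods (Assign a i e) = {a}"
| "mods (Flip a i) = {a}"
| "mods (Seq P Q) = mods P \<union> mods Q"
| "mods (Cond e P Q) = mods P \<union> mods Q"
| "mods (While e P) = mods P"

text \<open>An upper bound on the running time if every loop makes at most \<open>N\<close> iterations.\<close>

primrec cost :: "nat \<Rightarrow> prog \<Rightarrow> nat" where
  "cost N Skip = 0"
| "cost N (Assign a i e) = 1"
| "cost N (Flip a i) = 1"
| "cost N (Seq P Q) = cost N P + cost N Q + 1"
| "cost N (Cond e P Q) = cost N P + cost N Q + 1"
| "cost N (While e P) = N * (cost N P + 2) + 1"

text \<open>The program is a fixed term, and each level of loop nesting contributes one factor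
  \<open>N\<close>, so the nesting depth bounds the degree.\<close>

lemma cost_poly: "\<exists>q. \<forall>N. cost N P = poly q N"
proof (induction P)
  case Skip
  show ?case by (intro exI[of _ 0]) simp
next
  case (Seq P Q)
  then obtain p q where "\<forall>N. cost N P = poly p N" "\<forall>N. cost N Q = poly q N" by blast
  then show ?case by (intro exI[of _ "p + q + 1"]) simp
next
  case (Cond e P Q)
  then obtain p q where "\<forall>N. cost N P = poly p N" "\<forall>N. cost N Q = poly q N" by blast
  then show ?case by (intro exI[of _ "p + q + 1"]) simp
next
  case (While e P)
  then obtain p where "\<forall>N. cost N P = poly p N" by blast
  then show ?case by (intro exI[of _ "[:0, 1:] * (p + [:2:]) + 1"]) simp
qed (intro exI[of _ 1], simp)+

definition frame :: "nat set \<Rightarrow> memory \<Rightarrow> memory \<Rightarrow> bool" where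
  "frame M s s' \<longleftrightarrow> (\<forall>a. a \<notin> M \<longrightarrow> s' a = s a)"

lemma frameD: "frame M s s' \<Longrightarrow> a \<notin> M \<Longrightarrow> s' a = s a"
  by (simp add: frame_def)

lemma frame_refl [simp]: "frame M s s"
  by (simp add: frame_def)

lemma frame_trans: "frame M s s' \<Longrightarrow> frame M s' s'' \<Longrightarrow> frame M s s''"
  by (simp add: frame_def)

lemma frame_mono: "frame M s s' \<Longrightarrow> M \<subseteq> M' \<Longrightarrow> frame M' s s'"
  by (auto simp: frame_def)

lemma frame_store: "a \<in> M \<Longrightarrow> frame M s (store s a i x)"
  by (auto simp: frame_def store_def)

lemma store_other [simp]: "a \<noteq> b \<Longrightarrow> store s a i x b = s b"
  by (simp add: store_def)

lemma store_same [simp]: "store s a i x a = (s a)(i := x)"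
  by (simp add: store_def)

text \<open>Time bound and frame belong to the triple: a specification only mentions what a program
  computes, and \<open>wp_conseq\<close> supplies that all other arrays are unchanged.\<close>

definition wp :: "nat \<Rightarrow> prog \<Rightarrow> (memory \<Rightarrow> bool) \<Rightarrow> memory \<Rightarrow> bool" where
  "wp N P Q s \<longleftrightarrow> (\<exists>t s'. t \<le> cost N P \<and> steps t (P, s) (Skip, s') \<and> frame (mods P) s s' \<and> Q s')"

lemma wp_conseq:
  "wp N P Q s \<Longrightarrow> (\<And>s'. frame (mods P) s s' \<Longrightarrow> Q s' \<Longrightarrow> Q' s') \<Longrightarrow> wp N P Q' s"
  unfolding wp_def by blast

lemma wp_Skip: "Q s \<Longrightarrow> wp N Skip Q s"
  unfolding wp_def by (intro exI[of _ 0] exI[of _ s]) (auto intro: steps_0)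

lemma wp_Assign:
  "Q (store s a (eval_expr i s) (eval_expr e s)) \<Longrightarrow> wp N (Assign a i e) Q s"
  unfolding wp_def
  by (intro exI[of _ 1] exI[of _ "store s a (eval_expr i s) (eval_expr e s)"])
    (auto intro!: steps_1[simplified] frame_store)

lemma wp_Seq:
  assumes "wp N P (wp N R Q) s"
  shows "wp N (Seq P R) Q s"
proof -
  obtain t s' where 1: "t \<le> cost N P" "steps t (P, s) (Skip, s')" "frame (mods P) s s'" "wp N R Q s'"
    using assms unfolding wp_def[of _ P] by blast
  obtain t' s'' where 2: "t' \<le> cost N R" "steps t' (R, s') (Skip, s'')" "frame (mods R) s' s''" "Q s''"
    using 1(4) unfolding wp_def by blast
  have "steps t (Seq P R, s) (Seq Skip R, s')"
    using steps_Seq[OF 1(2)] by simp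
  moreover have "steps 1 (Seq Skip R, s') (R, s')"
    by (rule steps_1) auto
  ultimately have "steps (t + 1 + t') (Seq P R, s) (Skip, s'')"
    using 2(2) steps_trans by blast
  moreover have "frame (mods (Seq P R)) s s''"
    using 1(3) 2(3) by (auto simp: frame_def)
  ultimately show ?thesis
    unfolding wp_def using 1(1) 2(1,4) by (intro exI[of _ "t + 1 + t'"]) auto
qed

lemma wp_Cond:
  assumes "eval_expr e s \<noteq> 0 \<Longrightarrow> wp N P Q s" "eval_expr e s = 0 \<Longrightarrow> wp N R Q s"
  shows "wp N (Cond e P R) Q s"
proof -
  define X where "X = (if eval_expr e s \<noteq> 0 then P else R)"
  have "wp N X Q s"
    using assms by (auto simp: X_def)
  then obtain t s' where 1: "t \<le> cost N X" "steps t (X, s) (Skip, s')" "frame (mods X) s s'" "Q s'"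
    unfolding wp_def by blast
  have "steps (Suc t) (Cond e P R, s) (Skip, s')"
    by (rule steps_Suc[OF _ _ 1(2)]) (auto simp: X_def)
  moreover have "frame (mods (Cond e P R)) s s'"
    by (rule frame_mono[OF 1(3)]) (auto simp: X_def)
  moreover have "cost N X \<le> cost N P + cost N R"
    by (simp add: X_def)
  ultimately show ?thesis
    unfolding wp_def using 1(1,4) by (intro exI[of _ "Suc t"]) auto
qed

lemma wp_When:
  assumes "eval_expr e s \<noteq> 0 \<Longrightarrow> wp N P Q s" "eval_expr e s = 0 \<Longrightarrow> Q s"
  shows "wp N (Cond e P Skip) Q s"
  by (rule wp_Cond) (auto intro: assms wp_Skip)

definition For :: "nat \<Rightarrow> expr \<Rightarrow> prog \<Rightarrow> prog" where
  "For i e P = Seq (Assign i (Const 0) (Const 0))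
     (While (Less (Cell i (Const 0)) e)
        (Seq P (Assign i (Const 0) (Add (Cell i (Const 0)) (Const 1)))))"

lemma mods_For [simp]: "mods (For i e P) = insert i (mods P)"
  by (auto simp: For_def)

lemma wp_While:
  fixes I :: "nat \<Rightarrow> memory \<Rightarrow> bool"
  assumes body: "\<And>j s. j < hi \<Longrightarrow> I j s \<Longrightarrow> eval_expr e s \<noteq> 0 \<and> wp N P (I (Suc j)) s"
    and final: "\<And>s. I hi s \<Longrightarrow> eval_expr e s = 0"
    and "hi \<le> N" "I 0 s"
  shows "wp N (While e P) (I hi) s"
proof -
  \<comment> \<open>Induction on the number \<open>d\<close> of remaining iterations. Each costs two
    extra steps, unfolding the loop and discarding \<open>Skip\<close>; the final 1 is the failing
    test.\<close>
  have "\<exists>t s'. t \<le> d * (cost N P + 2) + 1 \<and> steps t (While e P, s) (Skip, s') \<and>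
      frame (mods P) s s' \<and> I hi s'" if "I j s" "j + d = hi" for d j s
    using that
  proof (induction d arbitrary: j s)
    case 0
    have "steps 1 (While e P, s) (Skip, s)"
      using final 0 by (intro steps_1) auto
    then show ?case using 0 by (intro exI[of _ 1] exI[of _ s]) auto
  next
    case (Suc d)
    have "eval_expr e s \<noteq> 0 \<and> wp N P (I (Suc j)) s"
      using body[of j s] Suc.prems by simp
    then obtain t s' where e: "eval_expr e s \<noteq> 0" and 1: "t \<le> cost N P" "steps t (P, s) (Skip, s')"
      "frame (mods P) s s'" "I (Suc j) s'"
      unfolding wp_def by blast
    obtain t' s'' where 2: "t' \<le> d * (cost N P + 2) + 1" "steps t' (While e P, s') (Skip, s'')"
      "frame (mods P) s' s''" "I hi s''"
      using Suc.IH[OF 1(4)] Suc.prems by auto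
    have "steps 1 (While e P, s) (Seq P (While e P), s)"
      using e by (intro steps_1) auto
    moreover have "steps t (Seq P (While e P), s) (Seq Skip (While e P), s')"
      using steps_Seq[OF 1(2)] by simp
    moreover have "steps 1 (Seq Skip (While e P), s') (While e P, s')"
      by (rule steps_1) auto
    ultimately have "steps (1 + t + 1 + t') (While e P, s) (Skip, s'')"
      using 2(2) steps_trans by blast
    then show ?case
      using 1(1) 2(1,4) frame_trans[OF 1(3) 2(3)] by (intro exI[of _ "1 + t + 1 + t'"] exI[of _ s'']) auto
  qed
  from this[OF \<open>I 0 s\<close>, of hi] obtain t s' where
    "t \<le> hi * (cost N P + 2) + 1" "steps t (While e P, s) (Skip, s')" "frame (mods P) s s'" "I hi s'"
    by auto
  moreover have "hi * (cost N P + 2) \<le> N * (cost N P + 2)"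
    using \<open>hi \<le> N\<close> by (rule mult_le_mono1)
  ultimately show ?thesis
    unfolding wp_def by (intro exI[of _ t] exI[of _ s']) auto
qed

lemma wp_For:
  fixes I :: "nat \<Rightarrow> memory \<Rightarrow> bool"
  assumes "i \<notin> mods P"
    and bound: "\<And>s'. frame (insert i (mods P)) s s' \<Longrightarrow> eval_expr e s' = hi"
    and "hi \<le> N"
    and init: "I 0 (store s i 0 0)"
    and body: "\<And>j s'. j < hi \<Longrightarrow> s' i 0 = j \<Longrightarrow> frame (insert i (mods P)) s s' \<Longrightarrow> I j s' \<Longrightarrow>
      wp N P (\<lambda>s''. I (Suc j) (store s'' i 0 (Suc j))) s'"
    and final: "\<And>s'. frame (insert i (mods P)) s s' \<Longrightarrow> I hi s' \<Longrightarrow> Q s'"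
  shows "wp N (For i e P) Q s"
proof -
  let ?B = "Seq P (Assign i (Const 0) (Add (Cell i (Const 0)) (Const 1)))"
  let ?I = "\<lambda>j s'. s' i 0 = j \<and> frame (insert i (mods P)) s s' \<and> I j s'"
  have "wp N (While (Less (Cell i (Const 0)) e) ?B) (?I hi) (store s i 0 0)"
  proof (rule wp_While)
    fix j s' assume j: "j < hi" and I: "?I j s'"
    have "wp N ?B (?I (Suc j)) s'"
    proof (intro wp_Seq wp_conseq[OF body[of j s']] wp_Assign)
      fix s'' assume f: "frame (mods P) s' s''" and *: "I (Suc j) (store s'' i 0 (Suc j))"
      have "s'' i = s' i" using f assms(1) by (simp add: frameD)
      then show "?I (Suc j) (store s'' i (eval_expr (Const 0) s'')
          (eval_expr (Add (Cell i (Const 0)) (Const 1)) s''))"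
        using I f * by (auto simp: frame_def store_def)
    qed (use j I in auto)
    then show "eval_expr (Less (Cell i (Const 0)) e) s' \<noteq> 0 \<and> wp N ?B (?I (Suc j)) s'"
      using bound j I by simp
  next
    fix s' assume "?I hi s'"
    then show "eval_expr (Less (Cell i (Const 0)) e) s' = 0"
      using bound by simp
  qed (auto simp: \<open>hi \<le> N\<close> init intro: frame_store)
  then have "wp N (While (Less (Cell i (Const 0)) e) ?B) Q (store s i 0 0)"
    by (rule wp_conseq) (auto intro: final)
  then show ?thesis
    unfolding For_def by (intro wp_Seq wp_Assign) simp
qed

lemma wp_run:
  assumes "wp N P Q s"
  shows "\<exists>s'. Q s' \<and> (\<forall>t\<ge>cost N P. run t (P, s) = return_pmf (Skip, s'))"
proof -
  obtain t s' where *: "t \<le> cost N P" "steps t (P, s) (Skip, s')" "Q s'"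
    using assms unfolding wp_def by blast
  then have "run t' (P, s) = return_pmf (Skip, s')" if "t' \<ge> cost N P" for t'
    using steps_run_ge[OF *(2)] that by (meson le_trans)
  then show ?thesis using *(3) by blast
qed

section \<open>Terminals and edge-disjoint paths\<close>

text \<open>The start vertex and the edges determine the intermediate vertices, so no vertex list is
  kept. Repetitions are allowed, which makes concatenation and reversal unconditional.\<close>

primrec joins :: "('e \<Rightarrow> 'v set) \<Rightarrow> 'v \<Rightarrow> 'e list \<Rightarrow> 'v \<Rightarrow> bool" where
  "joins en u [] v \<longleftrightarrow> u = v"
| "joins en u (e # es) v \<longleftrightarrow> (\<exists>x. en e = {u, x} \<and> joins en x es v)"

lemma joins_append: "joins en u (es @ fs) v \<longleftrightarrow> (\<exists>x. joins en u es x \<and> joins en x fs v)"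
  by (induction es arbitrary: u) auto

lemma joins_rev: "joins en u es v \<Longrightarrow> joins en v (rev es) u"
  by (induction es arbitrary: u) (auto simp: joins_append insert_commute)

lemma is_walk_Cons:
  "is_walk G (x # y # vs) (e # es) \<longleftrightarrow>
     x \<in> verts G \<and> e \<in> edges G \<and> ends G e = {x, y} \<and> is_walk G (y # vs) es"
  unfolding is_walk_def by (auto simp: All_less_Suc2)

lemma is_walk_joins:
  "is_walk G vs es \<Longrightarrow> joins (ends G) (hd vs) es (last vs)"
proof (induction es arbitrary: vs)
  case Nil
  then show ?case by (cases vs) (auto simp: is_walk_def)
next
  case (Cons e es)
  then obtain x y vs' where "vs = x # y # vs'"
    unfolding is_walk_def by (cases vs; cases "tl vs") auto
  with Cons.prems Cons.IH[of "y # vs'"] show ?case by (auto simp: is_walk_Cons intro!: exI[of _ y])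
qed

lemma is_path_joins:
  assumes "is_path G u vs es v"
  shows "joins (ends G) u es v" "set es \<subseteq> edges G"
  using assms is_walk_joins unfolding is_path_def is_walk_def by blast+

lemma is_path_distinct_ends:
  assumes "is_path G u vs es v"
  shows "distinct (map (ends G) es)"
  unfolding distinct_conv_nth
proof (intro allI impI)
  fix i j assume *: "i < length (map (ends G) es)" "j < length (map (ends G) es)" "i \<noteq> j"
  have d: "distinct vs" and l: "length vs = Suc (length es)"
    and e: "\<And>i. i < length es \<Longrightarrow> ends G (es ! i) = {vs ! i, vs ! Suc i}"
    using assms by (auto simp: is_path_def is_walk_def)
  show "map (ends G) es ! i \<noteq> map (ends G) es ! j"
    using * e[of i] e[of j] nth_eq_iff_index_eq[OF d] l by (auto simp: doubleton_eq_iff)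
qed

lemma is_path_length_less:
  assumes "is_path G u vs es v" "finite (verts G)"
  shows "length es < card (verts G)"
proof -
  have "distinct vs" "length vs = Suc (length es)" "set vs \<subseteq> verts G"
    using assms(1) by (auto simp: is_path_def is_walk_def)
  then show ?thesis
    using card_mono[OF assms(2), of "set vs"] by (simp add: distinct_card)
qed

lemma is_walk_drop:
  assumes "is_walk G vs es" "i \<le> length es"
  shows "is_walk G (drop i vs) (drop i es)"
  using assms set_drop_subset[of i vs] set_drop_subset[of i es] unfolding is_walk_def by auto

text \<open>Shortcutting from the front: if \<open>u\<close> already occurs on the path built for
  the remaining edges, everything before this occurrence is dropped.\<close>

lemma joins_is_path:
  assumes "joins (ends G) u es v" "set es \<subseteq> edges G" "u \<in> verts G"
    and "\<And>e. e \<in> edges G \<Longrightarrow> ends G e \<subseteq> verts G"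
  shows "\<exists>vs es'. is_path G u vs es' v \<and> length es' \<le> length es"
  using assms(1-3)
proof (induction es arbitrary: u)
  case Nil
  then show ?case
    by (intro exI[of _ "[u]"] exI[of _ "[]"]) (auto simp: is_path_def is_walk_def)
next
  case (Cons e es)
  then obtain x where x: "ends G e = {u, x}" "joins (ends G) x es v" by auto
  then have "x \<in> verts G" using Cons.prems assms(4)[of e] by auto
  then obtain vs es' where p: "is_path G x vs es' v" and le: "length es' \<le> length es"
    using Cons.IH[OF x(2)] Cons.prems by auto
  have w: "is_walk G vs es'" "distinct vs" "hd vs = x" "last vs = v" "length vs = Suc (length es')"
    using p by (auto simp: is_path_def is_walk_def)
  show ?case
  proof (cases "u \<in> set vs")
    case True
    then obtain i where i: "i < length vs" "vs ! i = u" by (auto simp: in_set_conv_nth)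
    have "is_path G u (drop i vs) (drop i es') v"
      using is_walk_drop[OF w(1), of i] w i by (auto simp: is_path_def hd_drop_conv_nth)
    then show ?thesis using le by (intro exI[of _ "drop i vs"] exI[of _ "drop i es'"]) auto
  next
    case False
    obtain vs' where vs: "vs = x # vs'" using w by (cases vs) auto
    have "is_path G u (u # vs) (e # es') v"
      using w x False Cons.prems unfolding vs by (auto simp: is_path_def is_walk_Cons)
    then show ?thesis using le by (intro exI[of _ "u # vs"] exI[of _ "e # es'"]) auto
  qed
qed

text \<open>Follow the walk until its weight first reaches \<open>\<theta> / 2\<close>, including
  the edge that crosses this threshold. \<open>Q\<close> stores each edge with the end at which it
  is entered, which is within weight less than \<open>\<theta> / 2\<close> of \<open>s\<close>; this
  pair, not the edge, will be charged to \<open>s\<close>. The factors 2 avoid halving in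
  \<open>nat\<close>.\<close>

lemma heavy_prefix:
  fixes w :: "'e \<Rightarrow> nat"
  assumes "joins en s es t" "distinct es"
  shows "\<exists>Q. finite Q \<and> inj_on fst Q \<and> fst ` Q \<subseteq> set es \<and> min \<theta> (2 * (\<Sum>e\<leftarrow>es. w e)) \<le> 2 * (\<Sum>x\<in>Q. w (fst x)) \<and>
    (\<forall>(e, a)\<in>Q. a \<in> en e \<and> (\<exists>p. joins en s p a \<and> set p \<subseteq> set es \<and> length p \<le> length es \<and>
        2 * (\<Sum>e\<leftarrow>p. w e) < \<theta>))"
  using assms
proof (induction es arbitrary: t rule: rev_induct)
  case Nil
  show ?case by (intro exI[of _ "{}"]) auto
next
  case (snoc e es)
  then obtain x where x: "joins en s es x" "en e = {x, t}" by (auto simp: joins_append)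
  then obtain Q where Q: "finite Q" "inj_on fst Q" "fst ` Q \<subseteq> set es"
      "min \<theta> (2 * (\<Sum>e\<leftarrow>es. w e)) \<le> 2 * (\<Sum>x\<in>Q. w (fst x))"
      "\<forall>(e, a)\<in>Q. a \<in> en e \<and> (\<exists>p. joins en s p a \<and> set p \<subseteq> set es \<and> length p \<le> length es \<and>
        2 * (\<Sum>e\<leftarrow>p. w e) < \<theta>)"
    using snoc.IH[OF x(1)] snoc.prems(2)[simplified] by blast
  have mono: "\<forall>(f, a)\<in>Q. a \<in> en f \<and> (\<exists>p. joins en s p a \<and> set p \<subseteq> set (es @ [e]) \<and>
      length p \<le> length (es @ [e]) \<and> 2 * (\<Sum>e\<leftarrow>p. w e) < \<theta>)"
    using Q(5) by (fastforce simp: le_Suc_eq)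
  show ?case
  proof (cases "\<theta> \<le> 2 * (\<Sum>e\<leftarrow>es. w e)")
    case True
    then show ?thesis using Q mono by (intro exI[of _ Q]) auto
  next
    case False
    have e: "e \<notin> fst ` Q" using Q(3) snoc.prems by auto
    then have sum: "(\<Sum>x\<in>insert (e, x) Q. w (fst x)) = w e + (\<Sum>x\<in>Q. w (fst x))"
      using Q(1) by (subst sum.insert) (auto simp: image_iff)
    have "joins en s es x \<and> set es \<subseteq> set (es @ [e]) \<and> length es \<le> length (es @ [e]) \<and>
        2 * (\<Sum>e\<leftarrow>es. w e) < \<theta>"
      using x False by auto
    then have "\<forall>(f, a)\<in>insert (e, x) Q. a \<in> en f \<and> (\<exists>p. joins en s p a \<and> set p \<subseteq> set (es @ [e]) \<and>
      length p \<le> length (es @ [e]) \<and> 2 * (\<Sum>e\<leftarrow>p. w e) < \<theta>)"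
      using mono x by auto
    moreover have "inj_on fst (insert (e, x) Q)"
      using Q(2) e by (auto simp: inj_on_insert)
    ultimately show ?thesis
      using Q(1,3,4) sum False by (intro exI[of _ "insert (e, x) Q"]) auto
  qed
qed

text \<open>Edge-disjoint walks without their vertex lists. Distinct end sets are what is kept of
  being paths: they forbid two parallel edges in one walk, and the property survives rerouting
  inside a parallel class.\<close>

definition link_system ::
    "('e \<Rightarrow> 'v set) \<Rightarrow> 'e set \<Rightarrow> nat \<Rightarrow> nat \<Rightarrow> 'v \<Rightarrow> 'v \<Rightarrow> (nat \<Rightarrow> 'e list) \<Rightarrow> bool" where
  "link_system en A k D u v P \<longleftrightarrow>
     (\<forall>i<k. joins en u (P i) v \<and> set (P i) \<subseteq> A \<and> length (P i) \<le> D \<and> distinct (map en (P i))) \<and>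
     (\<forall>i<k. \<forall>j<k. i \<noteq> j \<longrightarrow> set (P i) \<inter> set (P j) = {})"

text \<open>Balls of radius \<open>\<theta> / 2\<close> around the terminals are disjoint, and each of them contains
  the initial segments, of weight at least \<open>\<theta> / 2\<close>, of \<open>k\<close> edge-disjoint paths that leave it.
  An edge is counted at most once in each direction.\<close>

lemma terminal_distance_bound:
  fixes w :: "'e \<Rightarrow> nat" and S :: "'v set"
  assumes A: "finite A" "\<And>e. e \<in> A \<Longrightarrow> card (en e) = 2"
    and S: "finite S" "2 \<le> card S"
    and conn: "\<And>s t. s \<in> S \<Longrightarrow> t \<in> S \<Longrightarrow> s \<noteq> t \<Longrightarrow> \<exists>P. link_system en A k D s t P"
    and \<theta>: "\<And>s t es. s \<in> S \<Longrightarrow> t \<in> S \<Longrightarrow> s \<noteq> t \<Longrightarrow> joins en s es t \<Longrightarrow> set es \<subseteq> A \<Longrightarrow>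
      length es \<le> 2 * D \<Longrightarrow> \<theta> \<le> (\<Sum>e\<leftarrow>es. w e)"
  shows "card S * k * \<theta> \<le> 4 * (\<Sum>e\<in>A. w e)"
proof -
  define ball where "ball s = {a. \<exists>p. joins en s p a \<and> set p \<subseteq> A \<and> length p \<le> D \<and>
    2 * (\<Sum>e\<leftarrow>p. w e) < \<theta>}" for s
  have ball_disjoint: "ball s \<inter> ball t = {}" if st: "s \<in> S" "t \<in> S" "s \<noteq> t" for s t
  proof (rule ccontr)
    assume "ball s \<inter> ball t \<noteq> {}"
    then obtain a p q where p: "joins en s p a" "set p \<subseteq> A" "length p \<le> D" "2 * (\<Sum>e\<leftarrow>p. w e) < \<theta>"
      and q: "joins en t q a" "set q \<subseteq> A" "length q \<le> D" "2 * (\<Sum>e\<leftarrow>q. w e) < \<theta>"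
      by (auto simp: ball_def)
    \<comment> \<open>This walk has at most \<open>2 * D\<close> edges but weight below
      \<open>\<theta>\<close>: the hop bound for linking is twice the hop radius of a ball.\<close>
    have "joins en s (p @ rev q) t"
      using p(1) joins_rev[OF q(1)] by (auto simp: joins_append)
    then have "\<theta> \<le> (\<Sum>e\<leftarrow>p @ rev q. w e)"
      using st p q by (intro \<theta>) auto
    also have "\<dots> = (\<Sum>e\<leftarrow>p. w e) + (\<Sum>e\<leftarrow>q. w e)"
      by (simp add: rev_map[symmetric])
    finally show False using p q by simp
  qed
  define R where "R s Q \<longleftrightarrow> (\<forall>i<k. finite (Q i) \<and> inj_on fst (Q i) \<and> fst ` Q i \<subseteq> A \<and>
      \<theta> \<le> 2 * (\<Sum>x\<in>Q i. w (fst x)) \<and> (\<forall>(e, a)\<in>Q i. a \<in> en e \<and> a \<in> ball s) \<and>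
      (\<forall>j<k. i \<noteq> j \<longrightarrow> fst ` Q i \<inter> fst ` Q j = {}))" for s and Q :: "nat \<Rightarrow> ('e \<times> 'v) set"
  have "\<exists>Q. R s Q" if s: "s \<in> S" for s
  proof -
    obtain t where t: "t \<in> S" "t \<noteq> s"
      using S s by (metis One_nat_def card_le_Suc0_iff_eq not_less_eq_eq numeral_2_eq_2)
    obtain P where P: "link_system en A k D s t P" using conn s t by metis
    define R' where "R' i Q \<longleftrightarrow> finite Q \<and> inj_on fst Q \<and> fst ` Q \<subseteq> set (P i) \<and>
      \<theta> \<le> 2 * (\<Sum>x\<in>Q. w (fst x)) \<and> (\<forall>(e, a)\<in>Q. a \<in> en e \<and> a \<in> ball s)" for i Q
    have "\<exists>Q. R' i Q" if i: "i < k" for i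
    proof -
      have Pi: "joins en s (P i) t" "set (P i) \<subseteq> A" "length (P i) \<le> D" "distinct (P i)"
        using P i distinct_map by (auto simp: link_system_def)
      obtain Q where Q: "finite Q" "inj_on fst Q" "fst ` Q \<subseteq> set (P i)"
          "min \<theta> (2 * (\<Sum>e\<leftarrow>P i. w e)) \<le> 2 * (\<Sum>x\<in>Q. w (fst x))"
        and Q2: "\<forall>(e, a)\<in>Q. a \<in> en e \<and> (\<exists>p. joins en s p a \<and> set p \<subseteq> set (P i) \<and> length p \<le> length (P i) \<and>
        2 * (\<Sum>e\<leftarrow>p. w e) < \<theta>)"
        using heavy_prefix[OF Pi(1,4), of \<theta> w] by blast
      have "\<theta> \<le> (\<Sum>e\<leftarrow>P i. w e)" using Pi s t by (intro \<theta>[of s t]) auto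
      moreover have "\<forall>(e, a)\<in>Q. a \<in> en e \<and> a \<in> ball s"
      proof (safe, goal_cases)
        case (1 e a)
        then show ?case using Q2 by auto
      next
        case (2 e a)
        then obtain p where "joins en s p a \<and> set p \<subseteq> set (P i) \<and> length p \<le> length (P i) \<and>
          2 * (\<Sum>e\<leftarrow>p. w e) < \<theta>" using Q2 by auto
        then show ?case using Pi by (auto simp: ball_def intro!: exI[of _ p])
      qed
      ultimately show ?thesis unfolding R'_def using Q by (intro exI[of _ Q]) auto
    qed
    then obtain Q where "\<And>i. i < k \<Longrightarrow> R' i (Q i)" by metis
    note Q = this[unfolded R'_def]
    have "fst ` Q i \<inter> fst ` Q j = {}" if "i < k" "j < k" "i \<noteq> j" for i j
    proof -
      have "set (P i) \<inter> set (P j) = {}" using P that by (simp add: link_system_def)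
      moreover have "fst ` Q i \<subseteq> set (P i)" "fst ` Q j \<subseteq> set (P j)"
        using Q[OF that(1)] Q[OF that(2)] by simp_all
      ultimately show ?thesis by blast
    qed
    moreover have "fst ` Q i \<subseteq> A" if "i < k" for i
    proof -
      have "set (P i) \<subseteq> A" using P that by (simp add: link_system_def)
      moreover have "fst ` Q i \<subseteq> set (P i)" using Q[OF that] by simp
      ultimately show ?thesis by blast
    qed
    ultimately show ?thesis unfolding R_def using Q by (intro exI[of _ Q]) auto
  qed
  then obtain Q where R: "\<And>s. s \<in> S \<Longrightarrow> R s (Q s)" by metis
  have Q: "finite (Q s i) \<and> inj_on fst (Q s i) \<and> fst ` Q s i \<subseteq> A \<and>
      \<theta> \<le> 2 * (\<Sum>x\<in>Q s i. w (fst x)) \<and> (\<forall>(e, a)\<in>Q s i. a \<in> en e \<and> a \<in> ball s) \<and>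
      (\<forall>j<k. i \<noteq> j \<longrightarrow> fst ` Q s i \<inter> fst ` Q s j = {})" if "s \<in> S" "i < k" for s i
    using R that unfolding R_def by blast
  \<comment> \<open>For one terminal the paths are edge-disjoint; for two terminals the same edge
    may occur, but its recorded ends lie in disjoint balls.\<close>
  have disj: "Q s i \<inter> Q t j = {}" if "s \<in> S" "t \<in> S" "i < k" "j < k" "(s, i) \<noteq> (t, j)" for s t i j
  proof (cases "s = t")
    case True
    then have "fst ` Q s i \<inter> fst ` Q t j = {}" using Q[of s i] that by blast
    then show ?thesis by blast
  next
    case False
    then show ?thesis
      using ball_disjoint[OF that(1,2)] Q[OF that(1,3)] Q[OF that(2,4)] by fastforce
  qed
  let ?I = "S \<times> {..<k}"
  have "card S * k * \<theta> = (\<Sum>(s, i)\<in>?I. \<theta>)"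
    by (simp add: card_cartesian_product case_prod_unfold)
  also have "\<dots> \<le> (\<Sum>(s, i)\<in>?I. 2 * (\<Sum>x\<in>Q s i. w (fst x)))"
    using Q by (intro sum_mono) auto
  also have "\<dots> = 2 * (\<Sum>x\<in>(\<Union>(s, i)\<in>?I. Q s i). w (fst x))"
  proof -
    have "(\<Sum>x\<in>(\<Union>(s, i)\<in>?I. Q s i). w (fst x)) = (\<Sum>z\<in>?I. \<Sum>x\<in>(case z of (s, i) \<Rightarrow> Q s i). w (fst x))"
      using S Q disj by (intro sum.UNION_disjoint) auto
    then show ?thesis by (simp add: sum_distrib_left case_prod_unfold)
  qed
  \<comment> \<open>\<open>Sigma A en\<close> lists every edge once per end, so the 4 in the bound
    is 2 for the two ends times 2 for the radius \<open>\<theta> / 2\<close>.\<close>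
  also have "\<dots> \<le> 2 * (\<Sum>x\<in>Sigma A en. w (fst x))"
  proof -
    have "finite (Sigma A en)"
      using A card.infinite by (intro finite_SigmaI) fastforce+
    moreover have "(\<Union>(s, i)\<in>?I. Q s i) \<subseteq> Sigma A en"
      using Q by fastforce
    ultimately show ?thesis by (simp add: sum_mono2)
  qed
  also have "(\<Sum>x\<in>Sigma A en. w (fst x)) = (\<Sum>e\<in>A. \<Sum>a\<in>en e. w e)"
    using A card.infinite by (subst sum.Sigma) (fastforce simp: case_prod_unfold)+
  also have "\<dots> = 2 * (\<Sum>e\<in>A. w e)"
    using A by (simp add: sum_distrib_left)
  finally show ?thesis by simp
qed

section \<open>Thinning parallel classes to \<open>k\<close> edges\<close>

lemma card_low_rank:
  fixes C :: "nat set"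
  assumes "finite C"
  shows "card {e \<in> C. card {f \<in> C. f < e} < k} = min k (card C)"
proof -
  let ?r = "\<lambda>e. card {f \<in> C. f < e}"
  let ?B = "{e \<in> C. ?r e < k}"
  have mono: "?r e < ?r f" if "e \<in> C" "e < f" for e f
    using that assms by (intro psubset_card_mono) auto
  have inj: "inj_on ?r C"
    using mono by (intro linorder_inj_onI) fastforce+
  have "card ?B \<le> card {..<k}"
    using inj by (intro card_inj_on_le[of ?r]) (auto intro: inj_on_subset)
  moreover have "card ?B \<le> card C"
    using assms by (intro card_mono) auto
  moreover have "k \<le> card ?B" if "C - ?B \<noteq> {}"
  proof -
    \<comment> \<open>\<open>e\<close> is the least element of rank at least \<open>k\<close>.
      Everything below it belongs to \<open>?B\<close>, and these are \<open>?r e \<ge> k\<close>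
      elements.\<close>
    define e where "e = Min (C - ?B)"
    have e: "e \<in> C - ?B" using Min_in[of "C - ?B"] that assms by (simp add: e_def)
    have "{f \<in> C. f < e} \<subseteq> ?B"
    proof
      fix f assume f: "f \<in> {f \<in> C. f < e}"
      show "f \<in> ?B"
      proof (rule ccontr)
        assume "f \<notin> ?B"
        then have "e \<le> f" unfolding e_def using f assms by (intro Min_le) auto
        then show False using f by simp
      qed
    qed
    then have "?r e \<le> card ?B" using assms by (intro card_mono) auto
    moreover have "k \<le> ?r e" using e by auto
    ultimately show ?thesis by simp
  qed
  moreover have "?B = C" if "C - ?B = {}" using that by blast
  ultimately show ?thesis by (cases "C - ?B = {}") (auto simp: min_def)
qed

text \<open>Choosing by rank within the parallel class lets the program decide membership by
  counting earlier parallel edges, as in \<open>countP\<close>.\<close>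

definition active_edges :: "(nat \<Rightarrow> 'v set) \<Rightarrow> nat \<Rightarrow> nat \<Rightarrow> nat set" where
  "active_edges en m k = {e. e < m \<and> card {f. f < e \<and> en f = en e} < k}"

lemma active_edges_class:
  "active_edges en m k \<inter> {e. en e = c} =
    {e \<in> {e. e < m \<and> en e = c}. card {f \<in> {e. e < m \<and> en e = c}. f < e} < k}"
proof -
  have "{f \<in> {e. e < m \<and> en e = c}. f < e} = {f. f < e \<and> en f = en e}" if "e < m" "en e = c" for e
    using that by auto
  then show ?thesis by (auto simp: active_edges_def)
qed

lemma card_active_edges_class:
  "card (active_edges en m k \<inter> {e. en e = c}) = min k (card {e. e < m \<and> en e = c})"
  unfolding active_edges_class by (rule card_low_rank) simp

lemma card_active_edges_le:
  fixes en :: "nat \<Rightarrow> nat set"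
  assumes "\<And>e. e < m \<Longrightarrow> \<exists>a<n. \<exists>b<n. en e = {a, b}"
  shows "card (active_edges en m k) \<le> k * n ^ 2"
proof -
  let ?I = "{..<n} \<times> {..<n}" and ?f = "\<lambda>p. active_edges en m k \<inter> {e. en e = {fst p, snd p}}"
  have fin: "finite (active_edges en m k)" by (auto simp: active_edges_def)
  have "active_edges en m k \<subseteq> (\<Union>p\<in>?I. ?f p)"
    using assms by (fastforce simp: active_edges_def)
  then have "card (active_edges en m k) \<le> card (\<Union>p\<in>?I. ?f p)"
    using fin by (intro card_mono) auto
  also have "\<dots> \<le> (\<Sum>p\<in>?I. card (?f p))"
    by (intro card_UN_le) auto
  also have "\<dots> \<le> (\<Sum>p\<in>?I. k)"
    by (intro sum_mono) (simp add: card_active_edges_class)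
  finally show ?thesis by (simp add: card_cartesian_product power2_eq_square mult.commute)
qed

text \<open>A path uses at most one edge of each parallel class, so in a class with more than
  \<open>k\<close> edges the \<open>i\<close>-th of \<open>k\<close> paths can be rerouted along the \<open>i\<close>-th active edge.\<close>

lemma link_system_active:
  assumes "link_system en {..<m} k D u v P"
  shows "\<exists>P'. link_system en (active_edges en m k) k D u v P'"
proof -
  let ?A = "active_edges en m k"
  have "\<exists>g. inj_on g {..<k} \<and> g ` {..<k} \<subseteq> ?A \<inter> {e. en e = c}" if "k \<le> card {e. e < m \<and> en e = c}" for c
  proof -
    have "finite (?A \<inter> {e. en e = c})" by (auto simp: active_edges_def)
    moreover have "card {..<k} \<le> card (?A \<inter> {e. en e = c})"
      using that by (simp add: card_active_edges_class)
    ultimately show ?thesis using card_le_inj[of "{..<k}"] by blast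
  qed
  then obtain g where g: "\<And>c. k \<le> card {e. e < m \<and> en e = c} \<Longrightarrow>
      inj_on (g c) {..<k} \<and> g c ` {..<k} \<subseteq> ?A \<inter> {e. en e = c}"
    by metis
  define h where "h i e = (if k \<le> card {f. f < m \<and> en f = en e} then g (en e) i else e)" for i e
  have en_h: "en (h i e) = en e" if "i < k" for i e
    using g[of "en e"] that by (auto simp: h_def)
  have h_active: "h i e \<in> ?A" if "i < k" "e < m" for i e
  proof (cases "k \<le> card {f. f < m \<and> en f = en e}")
    case True
    then show ?thesis using g[OF True] that by (auto simp: h_def)
  next
    case False
    have "card {f. f < e \<and> en f = en e} \<le> card {f. f < m \<and> en f = en e}"
      using that by (intro card_mono) auto
    then show ?thesis using False that by (auto simp: h_def active_edges_def)
  qed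
  \<comment> \<open>\<open>h\<close> preserves end sets, so a collision happens inside one class: in
    a large class paths \<open>i \<noteq> j\<close> get different edges, in a small one
    \<open>h\<close> is the identity.\<close>
  have h_inj: "e = f" if "i < k" "j < k" "i \<noteq> j" "h i e = h j f" for i j e f
  proof -
    have "en e = en f" using en_h that by metis
    then show ?thesis using that g[of "en e"] by (auto simp: h_def inj_on_def split: if_splits)
  qed
  have joins_h: "joins en u (map (h i) es) v" if "joins en u es v" "i < k" for i es u
    using that by (induction es arbitrary: u) (auto simp: en_h)
  have "link_system en ?A k D u v (\<lambda>i. map (h i) (P i))"
    unfolding link_system_def
  proof (intro conjI allI impI)
    fix i assume i: "i < k"
    have P: "joins en u (P i) v" "set (P i) \<subseteq> {..<m}" "length (P i) \<le> D" "distinct (map en (P i))"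
      using assms i by (simp_all add: link_system_def)
    show "joins en u (map (h i) (P i)) v" "length (map (h i) (P i)) \<le> D"
      using P i joins_h by auto
    show "set (map (h i) (P i)) \<subseteq> ?A" using P i h_active by auto
    have "map en (map (h i) (P i)) = map en (P i)" using en_h[OF i] by simp
    then show "distinct (map en (map (h i) (P i)))" using P by (simp only:)
  next
    fix i j assume ij: "i < k" "j < k" "i \<noteq> j"
    have "set (P i) \<inter> set (P j) = {}" using assms ij by (simp add: link_system_def)
    moreover have "x \<in> set (P i) \<inter> set (P j)" if "x \<in> set (P i)" "y \<in> set (P j)" "h i x = h j y" for x y
      using h_inj[OF ij that(3)] that by simp
    ultimately show "set (map (h i) (P i)) \<inter> set (map (h j) (P j)) = {}" by fastforce
  qed
  then show ?thesis by blast
qed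

lemma kD_connected_link_system:
  assumes "kD_connected G k D" "u \<in> verts G" "v \<in> verts G" "u \<noteq> v" "finite (verts G)"
  shows "\<exists>P. link_system (ends G) (edges G) k (min D (card (verts G))) u v P"
proof -
  obtain vs es where p: "\<And>i. i < k \<Longrightarrow> is_path G u (vs i) (es i) v \<and> length (es i) \<le> D"
    and d: "\<And>i j. i < k \<Longrightarrow> j < k \<Longrightarrow> i \<noteq> j \<Longrightarrow> set (es i) \<inter> set (es j) = {}"
    using assms unfolding kD_connected_def by metis
  have "link_system (ends G) (edges G) k (min D (card (verts G))) u v es"
    unfolding link_system_def
  proof (intro conjI allI impI)
    fix i assume "i < k"
    then have i: "is_path G u (vs i) (es i) v" "length (es i) \<le> D" using p by auto
    show "joins (ends G) u (es i) v" "set (es i) \<subseteq> edges G" "distinct (map (ends G) (es i))"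
        "length (es i) \<le> min D (card (verts G))"
      using is_path_joins[OF i(1)] is_path_distinct_ends[OF i(1)]
        is_path_length_less[OF i(1) assms(5)] i(2) by simp_all
  qed (use d in auto)
  then show ?thesis by blast
qed

text \<open>A vertex with \<open>sz c \<noteq> 0\<close> is the center of a cluster with \<open>sz c\<close> vertices; a cluster
  is only ever absorbed by one that is at least as large.\<close>

definition clustered ::
    "('e \<Rightarrow> 'v set) \<Rightarrow> 'e set \<Rightarrow> 'v set \<Rightarrow> nat \<Rightarrow> ('v \<Rightarrow> nat) \<Rightarrow> bool" where
  "clustered en H V L sz \<longleftrightarrow> (\<forall>v\<in>V. \<exists>c\<in>V. \<exists>j es. joins en v es c \<and> set es \<subseteq> H \<and>
     length es \<le> j * L \<and> 2 ^ j \<le> sz c)"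

text \<open>Vertices of the absorbed cluster append \<open>p\<close> and raise their exponent
  \<open>j\<close> by one, paid for by \<open>2 * sz u \<le> sz u + sz c\<close>; all others keep
  their witnesses.\<close>

lemma clustered_merge:
  assumes cl: "clustered en H V L sz" and c: "c \<in> V" "c \<noteq> u" "sz u \<le> sz c"
    and p: "joins en u p c" "length p \<le> L"
  shows "clustered en (H \<union> set p) V L (sz(c := sz u + sz c, u := 0))"
  unfolding clustered_def
proof
  fix v assume "v \<in> V"
  then obtain d j es where d: "d \<in> V" "joins en v es d" "set es \<subseteq> H" "length es \<le> j * L" "2 ^ j \<le> sz d"
    using cl unfolding clustered_def by blast
  show "\<exists>d\<in>V. \<exists>j es. joins en v es d \<and> set es \<subseteq> H \<union> set p \<and> length es \<le> j * L \<and>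
      2 ^ j \<le> (sz(c := sz u + sz c, u := 0)) d"
  proof (cases "d = u")
    case True
    have "joins en v (es @ p) c" using d p True by (auto simp: joins_append)
    moreover have "set (es @ p) \<subseteq> H \<union> set p" "length (es @ p) \<le> Suc j * L"
      using d p by auto
    moreover have "2 ^ Suc j \<le> (sz(c := sz u + sz c, u := 0)) c"
      using d c True by simp
    ultimately show ?thesis using c(1) by blast
  next
    case False
    then have "2 ^ j \<le> (sz(c := sz u + sz c, u := 0)) d" using d by auto
    then show ?thesis using d by blast
  qed
qed

lemma sum_merge:
  fixes sz :: "'v \<Rightarrow> nat"
  assumes "finite V" "u \<in> V" "c \<in> V" "c \<noteq> u"
  shows "sum (sz(c := sz u + sz c, u := 0)) V = sum sz V"
proof -
  have split: "sum f V = f u + f c + sum f (V - {u, c})" for f :: "'v \<Rightarrow> nat"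
  proof -
    have "V - {u} - {c} = V - {u, c}" by auto
    then show ?thesis
      using sum.remove[of V u f] sum.remove[of "V - {u}" c f] assms by simp
  qed
  have "sum (sz(c := sz u + sz c, u := 0)) (V - {u, c}) = sum sz (V - {u, c})"
    by (intro sum.cong) auto
  then show ?thesis
    unfolding split using assms by simp
qed

section \<open>Spanning trees from level functions\<close>

lemma layered_no_cycle:
  fixes lev :: "'v \<Rightarrow> nat"
  assumes layer: "\<And>e. e \<in> T \<Longrightarrow> \<exists>a b. ends G e = {a, b} \<and> lev b = Suc (lev a)"
    and uniq: "\<And>e f a a' b. e \<in> T \<Longrightarrow> f \<in> T \<Longrightarrow> ends G e = {a, b} \<Longrightarrow> ends G f = {a', b} \<Longrightarrow>
      lev b = Suc (lev a) \<Longrightarrow> lev b = Suc (lev a') \<Longrightarrow> e = f"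
  shows "\<not> is_cycle (spanning_subgraph G T) vs es"
proof
  assume cyc: "is_cycle (spanning_subgraph G T) vs es"
  define L where "L = length es"
  have L: "L > 0" "length vs = Suc L" and T: "\<And>i. i < L \<Longrightarrow> es ! i \<in> T"
    and ends: "\<And>i. i < L \<Longrightarrow> ends G (es ! i) = {vs ! i, vs ! Suc i}"
    and hd_last: "hd vs = last vs" and dist: "distinct es"
    using cyc by (auto simp: is_cycle_def is_walk_def L_def spanning_subgraph_def)
  have "vs \<noteq> []" using L by auto
  then have cl: "vs ! 0 = vs ! L"
    using hd_last L by (simp add: hd_conv_nth last_conv_nth)
  have step: "lev (vs ! i) = Suc (lev (vs ! Suc i)) \<or> lev (vs ! Suc i) = Suc (lev (vs ! i))" if "i < L" for i
    using layer[OF T[OF that]] ends[OF that] by (auto simp: doubleton_eq_iff)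
  \<comment> \<open>A highest vertex of the cycle: both of its cycle edges lead one level down, so
    each is its unique parent edge and they coincide.\<close>
  have "Max (lev ` set vs) \<in> lev ` set vs" using L by (intro Max_in) auto
  then obtain i0 where i0: "i0 < Suc L" "lev (vs ! i0) = Max (lev ` set vs)"
    using L by (auto simp: in_set_conv_nth)
  \<comment> \<open>Positions 0 and \<open>L\<close> carry the same vertex. \<open>i\<close>
    presents the highest vertex as the end of edge \<open>i - 1\<close>, and \<open>i'\<close> as
    the start of edge \<open>i'\<close>.\<close>
  define i where "i = (if i0 = 0 then L else i0)"
  have i: "i > 0" "i \<le> L" "lev (vs ! i) = Max (lev ` set vs)"
    using i0 cl L by (auto simp: i_def)
  define i' where "i' = (if i = L then 0 else i)"
  have i': "i' < L" "vs ! i' = vs ! i" using i L cl by (auto simp: i'_def)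
  have max: "lev (vs ! j) \<le> lev (vs ! i)" if "j \<le> L" for j
    unfolding i(3) using L that by (intro Max_ge) auto
  have "lev (vs ! i) = Suc (lev (vs ! (i - 1)))"
  proof -
    have "i - 1 < L" "Suc (i - 1) = i" "i - 1 \<le> L" using i by simp_all
    then show ?thesis using step[of "i - 1"] max[of "i - 1"] by (metis Suc_n_not_le_n)
  qed
  moreover have "lev (vs ! i) = Suc (lev (vs ! Suc i'))"
    using step[OF i'(1)] max[of "Suc i'"] i' by (metis Suc_n_not_le_n Suc_leI)
  moreover have "ends G (es ! (i - 1)) = {vs ! (i - 1), vs ! i}"
    using ends[of "i - 1"] i by simp
  moreover have "ends G (es ! i') = {vs ! Suc i', vs ! i}"
    using ends[of i'] i' by (simp add: insert_commute)
  moreover have "es ! (i - 1) \<in> T" "es ! i' \<in> T" using T i i' by auto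
  ultimately have "es ! (i - 1) = es ! i'" using uniq by metis
  then have "i - 1 = i'" using dist i i' nth_eq_iff_index_eq[of es "i - 1" i'] by (auto simp: L_def)
  then have "L = 1" using i by (auto simp: i'_def split: if_splits)
  then show False using step[of 0] cl by simp
qed

text \<open>Following parents lowers the level by one each time, so every vertex reaches
  \<open>r\<close> by \<open>lev v - lev r\<close> edges, and two vertices are connected through
  \<open>r\<close>. The level of \<open>r\<close> is kept general because the search below gives the
  root level 1.\<close>

lemma layered_spanning_tree:
  fixes lev :: "'v \<Rightarrow> nat"
  assumes G: "finite (verts G)" "\<And>e. e \<in> edges G \<Longrightarrow> ends G e \<subseteq> verts G" "r \<in> verts G" "T \<subseteq> edges G"
    and layer: "\<And>e. e \<in> T \<Longrightarrow> \<exists>a b. ends G e = {a, b} \<and> lev b = Suc (lev a)"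
    and uniq: "\<And>e f a a' b. e \<in> T \<Longrightarrow> f \<in> T \<Longrightarrow> ends G e = {a, b} \<Longrightarrow> ends G f = {a', b} \<Longrightarrow>
      lev b = Suc (lev a) \<Longrightarrow> lev b = Suc (lev a') \<Longrightarrow> e = f"
    and parent: "\<And>v. v \<in> verts G \<Longrightarrow> v \<noteq> r \<Longrightarrow> \<exists>e\<in>T. \<exists>a. ends G e = {a, v} \<and> lev v = Suc (lev a)"
    and depth: "\<And>v. v \<in> verts G \<Longrightarrow> lev v \<le> lev r + R"
  shows "is_spanning_tree G T" "graph_diameter (spanning_subgraph G T) \<le> 2 * R"
proof -
  let ?T = "spanning_subgraph G T"
  have T: "verts ?T = verts G" "edges ?T = T" "ends ?T = ends G"
    by (simp_all add: spanning_subgraph_def)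
  have to_root: "\<exists>es. joins (ends G) v es r \<and> set es \<subseteq> T \<and> length es \<le> R" if "v \<in> verts G" for v
  proof -
    have "\<exists>es. joins (ends G) v es r \<and> set es \<subseteq> T \<and> lev r + length es = lev v"
      using that
    proof (induction "lev v" arbitrary: v rule: less_induct)
      case less
      show ?case
      proof (cases "v = r")
        case True
        then show ?thesis by (intro exI[of _ "[]"]) auto
      next
        case False
        then obtain e a where e: "e \<in> T" "ends G e = {a, v}" "lev v = Suc (lev a)"
          using parent less.prems by blast
        then have "a \<in> verts G" using G(2)[of e] G(4) by auto
        then obtain es where "joins (ends G) a es r \<and> set es \<subseteq> T \<and> lev r + length es = lev a"
          using less.hyps e by (metis lessI)
        then show ?thesis using e by (intro exI[of _ "e # es"]) auto
      qed
    qed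
    then show ?thesis using depth[OF that] by fastforce
  qed
  have path: "\<exists>vs es. is_path ?T u vs es v \<and> length es \<le> 2 * R" if "u \<in> verts G" "v \<in> verts G" for u v
  proof -
    obtain p where "joins (ends G) u p r" "set p \<subseteq> T" "length p \<le> R"
      using to_root[OF \<open>u \<in> _\<close>] by blast
    moreover obtain q where "joins (ends G) v q r" "set q \<subseteq> T" "length q \<le> R"
      using to_root[OF \<open>v \<in> _\<close>] by blast
    ultimately have "joins (ends ?T) u (p @ rev q) v" "set (p @ rev q) \<subseteq> edges ?T" "length (p @ rev q) \<le> 2 * R"
      using joins_rev by (fastforce simp: joins_append T)+
    moreover have "\<And>e. e \<in> edges ?T \<Longrightarrow> ends ?T e \<subseteq> verts ?T" using G T by auto
    ultimately show ?thesis
      using joins_is_path[of ?T u "p @ rev q" v] that T by (metis order_trans)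
  qed
  have "\<not> is_cycle ?T vs es" for vs es
    by (rule layered_no_cycle[where lev = lev]; fact layer uniq)
  moreover have "graph_connected ?T"
    unfolding graph_connected_def T using path G(3) by blast
  ultimately show "is_spanning_tree G T"
    unfolding is_spanning_tree_def is_tree_def using G(4) by blast
  have "graph_dist ?T u v \<le> 2 * R" if "u \<in> verts G" "v \<in> verts G" for u v
  proof -
    obtain vs es where "is_path ?T u vs es v" "length es \<le> 2 * R" using path \<open>u \<in> _\<close> \<open>v \<in> _\<close> by blast
    then have "graph_dist ?T u v \<le> length es"
      unfolding graph_dist_def by (intro Least_le) auto
    then show ?thesis using \<open>length es \<le> 2 * R\<close> by simp
  qed
  moreover have "finite {graph_dist ?T u v |u v. u \<in> verts G \<and> v \<in> verts G}"
    using finite_image_set2[of "\<lambda>u. u \<in> verts G" "\<lambda>v. v \<in> verts G"] G(1) by simp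
  ultimately show "graph_diameter ?T \<le> 2 * R"
    unfolding graph_diameter_def T using G(3) by (subst Max_le_iff) auto
qed

text \<open>\<open>harm n - ln n\<close> is decreasing and equals 1 at \<open>n = 1\<close>.\<close>

lemma harm_le_ln:
  assumes "n > 0"
  shows "harm n \<le> 1 + ln (real n)"
proof -
  obtain m where m: "n = Suc m" using assms by (cases n) auto
  have "harm (Suc m) - ln (real (Suc m)) \<le> harm (Suc 0) - ln (real (Suc 0))"
    using decseq_harm_diff_ln by (rule decseqD) simp
  then show ?thesis unfolding m by (simp add: harm_expand)
qed

section \<open>Hop-bounded distance tables\<close>

text \<open>Array 0 is never written and array 1 receives the output. \<open>aDD\<close>: twice the length bound;
  \<open>aBIG\<close>: a number above the total weight, used as infinity; \<open>aROW\<close>: start of the current output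
  row; \<open>aW\<close>: edge weights, 0 for discarded edges; \<open>aSZ\<close>: cluster sizes, 0 for vertices that are
  not centers; \<open>aH\<close>: the linked subgraph; \<open>aF\<close>, \<open>aPE\<close>, \<open>aPV\<close>: the distance table from center
  \<open>cU\<close>, with \<open>aOFF\<close> the start of its current layer; \<open>aBEST\<close>, \<open>aBU\<close>, \<open>aBV\<close>, \<open>aPS\<close>: the closest
  pair of centers so far and a walk between them; \<open>aX\<close>, \<open>aO\<close>: position while tracing a walk;
  \<open>aLEV\<close>, \<open>aT\<close>, \<open>aR\<close>: breadth-first levels (1 at the root, 0 if unreached), tree and root.\<close>

abbreviation (input) "aDD \<equiv> 2 :: nat"
abbreviation (input) "aBIG \<equiv> 3 :: nat"
abbreviation (input) "aROW \<equiv> 4 :: nat"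
abbreviation (input) "aW \<equiv> 5 :: nat"
abbreviation (input) "aSZ \<equiv> 6 :: nat"
abbreviation (input) "aH \<equiv> 7 :: nat"
abbreviation (input) "aF \<equiv> 8 :: nat"
abbreviation (input) "aPE \<equiv> 9 :: nat"
abbreviation (input) "aPV \<equiv> 10 :: nat"
abbreviation (input) "aOFF \<equiv> 11 :: nat"
abbreviation (input) "aBEST \<equiv> 12 :: nat"
abbreviation (input) "aBU \<equiv> 13 :: nat"
abbreviation (input) "aBV \<equiv> 14 :: nat"
abbreviation (input) "aPS \<equiv> 15 :: nat"
abbreviation (input) "aX \<equiv> 16 :: nat"
abbreviation (input) "aO \<equiv> 17 :: nat"
abbreviation (input) "aLEV \<equiv> 18 :: nat"
abbreviation (input) "aT \<equiv> 19 :: nat"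
abbreviation (input) "aR \<equiv> 20 :: nat"
abbreviation (input) "aCNT \<equiv> 21 :: nat"
abbreviation (input) "cL \<equiv> 22 :: nat"
abbreviation (input) "cM \<equiv> 23 :: nat"
abbreviation (input) "cU \<equiv> 24 :: nat"
abbreviation (input) "cH \<equiv> 25 :: nat"
abbreviation (input) "cV \<equiv> 26 :: nat"
abbreviation (input) "cE \<equiv> 27 :: nat"
abbreviation (input) "cF \<equiv> 28 :: nat"

abbreviation var :: "nat \<Rightarrow> expr" where "var a \<equiv> Cell a (Const 0)"
abbreviation setv :: "nat \<Rightarrow> expr \<Rightarrow> prog" where "setv a \<equiv> Assign a (Const 0)"
abbreviation "kE \<equiv> Cell 0 (Const 1)"
abbreviation "nE \<equiv> Cell 0 (Const 2)"
abbreviation "mE \<equiv> Cell 0 (Const 3)"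
abbreviation "When e P \<equiv> Cond e P Skip"

definition srcE :: "expr \<Rightarrow> expr" where "srcE e = Cell 0 (Add (Const 4) (Add e e))"
definition dstE :: "expr \<Rightarrow> expr" where "dstE e = Cell 0 (Add (Const 5) (Add e e))"
definition eqE :: "expr \<Rightarrow> expr \<Rightarrow> expr" where "eqE e f = Sub (Const 1) (Add (Less e f) (Less f e))"
definition andE :: "expr \<Rightarrow> expr \<Rightarrow> expr" where "andE e f = Less (Const 1) (Add e f)"

lemma eval_eqE [simp]: "eval_expr (eqE e f) s = of_bool (eval_expr e s = eval_expr f s)"
  by (auto simp: eqE_def)

lemma eval_andE [simp]:
  "eval_expr e s \<le> 1 \<Longrightarrow> eval_expr f s \<le> 1 \<Longrightarrow>
   eval_expr (andE e f) s = of_bool (eval_expr e s \<noteq> 0 \<and> eval_expr f s \<noteq> 0)"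
  by (auto simp: andE_def)

definition src_of :: "(nat \<Rightarrow> nat) \<Rightarrow> nat \<Rightarrow> nat" where "src_of g e = g (4 + (e + e))"
definition dst_of :: "(nat \<Rightarrow> nat) \<Rightarrow> nat \<Rightarrow> nat" where "dst_of g e = g (5 + (e + e))"

lemma eval_srcE [simp]: "eval_expr (srcE e) s = src_of (s 0) (eval_expr e s)"
  by (simp add: srcE_def src_of_def)

lemma eval_dstE [simp]: "eval_expr (dstE e) s = dst_of (s 0) (eval_expr e s)"
  by (simp add: dstE_def dst_of_def)

text \<open>\<open>g\<close> is the content of array 0, with \<open>D\<close>, \<open>k\<close>,
  \<open>n\<close> and the number of edges in cells 0 to 3. \<open>N\<close> is the iteration bound
  of \<open>cost\<close>; it must cover \<open>2 * g 2\<close> because a distance table can have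
  that many layers.\<close>

locale ram_input =
  fixes g :: "nat \<Rightarrow> nat" and en :: "nat \<Rightarrow> nat set" and N :: nat
  assumes en: "e < g 3 \<Longrightarrow> en e = {src_of g e, dst_of g e}"
    and src: "e < g 3 \<Longrightarrow> src_of g e < g 2"
    and dst: "e < g 3 \<Longrightarrow> dst_of g e < g 2"
    and loopless: "e < g 3 \<Longrightarrow> src_of g e \<noteq> dst_of g e"
    and bounds: "g 1 \<le> N" "2 * g 2 \<le> N" "g 3 \<le> N"
begin

abbreviation "k \<equiv> g 1"
abbreviation "n \<equiv> g 2"
abbreviation "m \<equiv> g 3"

lemma n_le: "n \<le> N"
  using bounds(2) by simp

definition support :: "(nat \<Rightarrow> nat) \<Rightarrow> nat set" where
  "support w = {e. e < m \<and> w e \<noteq> 0}"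

text \<open>Directed copies of the edges of nonzero weight. The index \<open>i\<close> is the
  progress of a loop over the edges, so that loop invariants can speak of the darts treated so
  far.\<close>

definition darts :: "(nat \<Rightarrow> nat) \<Rightarrow> nat \<Rightarrow> (nat \<times> nat \<times> nat) set" where
  "darts w i = {(e, a, b). e < i \<and> e < m \<and> w e \<noteq> 0 \<and>
     (a, b) \<in> {(src_of g e, dst_of g e), (dst_of g e, src_of g e)}}"

lemma darts_0 [simp]: "darts w 0 = {}"
  by (auto simp: darts_def)

lemma darts_Suc: "i < m \<Longrightarrow> w i \<noteq> 0 \<Longrightarrow>
  darts w (Suc i) = insert (i, dst_of g i, src_of g i) (insert (i, src_of g i, dst_of g i) (darts w i))"
  by (auto simp: darts_def less_Suc_eq)

lemma darts_Suc_zero: "w i = 0 \<Longrightarrow> darts w (Suc i) = darts w i"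
  by (auto simp: darts_def less_Suc_eq)

lemma darts_bound: "(e, a, b) \<in> darts w i \<Longrightarrow> a < n \<and> b < n"
  using src dst by (auto simp: darts_def)

lemma in_darts_iff:
  "(e, a, b) \<in> darts w m \<longleftrightarrow> e \<in> support w \<and> en e = {a, b}"
  by (cases "e < m") (auto simp: darts_def support_def en doubleton_eq_iff)

text \<open>\<open>Fn\<close> is the layer after \<open>Fp\<close>. The entry \<open>PE v = 0\<close> means that the value at \<open>v\<close> was
  inherited, otherwise it came through the edge \<open>PE v - 1\<close> from \<open>PV v\<close>.\<close>

definition layer_ok :: "(nat \<Rightarrow> nat) \<Rightarrow> (nat \<times> nat \<times> nat) set \<Rightarrow> (nat \<Rightarrow> nat) \<Rightarrow> (nat \<Rightarrow> nat) \<Rightarrow>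
    (nat \<Rightarrow> nat) \<Rightarrow> (nat \<Rightarrow> nat) \<Rightarrow> bool" where
  "layer_ok w X Fp Fn PE PV \<longleftrightarrow>
     (\<forall>v<n. Fn v \<le> Fp v \<and> (PE v = 0 \<and> Fn v = Fp v \<or>
        (\<exists>e\<in>support w. PE v = Suc e \<and> PV v < n \<and> en e = {v, PV v} \<and> Fn v = Fp (PV v) + w e))) \<and>
     (\<forall>(e, a, b)\<in>X. Fn b \<le> Fp a + w e)"

lemma layer_ok_cong:
  assumes "layer_ok w (darts w i) Fp Fn PE PV"
    and "\<And>v. v < n \<Longrightarrow> Fp' v = Fp v" "\<And>v. v < n \<Longrightarrow> Fn' v = Fn v"
      "\<And>v. v < n \<Longrightarrow> PE' v = PE v" "\<And>v. v < n \<Longrightarrow> PV' v = PV v"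
  shows "layer_ok w (darts w i) Fp' Fn' PE' PV'"
  unfolding layer_ok_def
proof (intro conjI allI impI ballI, goal_cases)
  case (1 v)
  then show ?case using assms unfolding layer_ok_def by simp
next
  case (2 v)
  then have "PE v = 0 \<and> Fn v = Fp v \<or>
      (\<exists>e\<in>support w. PE v = Suc e \<and> PV v < n \<and> en e = {v, PV v} \<and> Fn v = Fp (PV v) + w e)"
    using assms(1) unfolding layer_ok_def by blast
  then show ?case using assms(2-)[OF 2] assms(2) by (metis (no_types, lifting))
next
  case (3 x)
  obtain e a b where x: "x = (e, a, b)" by (cases x)
  then have "a < n" "b < n" using 3 darts_bound by auto
  then show ?case using 3 assms unfolding layer_ok_def x by fastforce
qed

text \<open>Relaxation reads the old layer only, so lowering \<open>Fn b\<close> cannot break an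
  inequality established for an earlier dart.\<close>

lemma layer_ok_relax:
  assumes "layer_ok w X Fp Fn PE PV" "e \<in> support w" "en e = {a, b}" "a < n" "Fp a + w e < Fn b"
  shows "layer_ok w (insert (e, a, b) X) Fp (Fn(b := Fp a + w e)) (PE(b := Suc e)) (PV(b := a))"
proof -
  have "\<forall>(f, x, y)\<in>X. (Fn(b := Fp a + w e)) y \<le> Fp x + w f"
    using assms unfolding layer_ok_def by fastforce
  then show ?thesis
    using assms unfolding layer_ok_def by (auto simp: insert_commute intro: less_imp_le order_trans)
qed

lemma layer_ok_keep:
  assumes "layer_ok w X Fp Fn PE PV" "\<not> Fp a + w e < Fn b"
  shows "layer_ok w (insert (e, a, b) X) Fp Fn PE PV"
  using assms unfolding layer_ok_def by auto

text \<open>There is no multiplication, so layer \<open>h\<close> is addressed by a running offset \<open>h * n\<close>.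
  Layers are kept separate because following parent pointers of the final
  distances could exceed the allowed number of edges.\<close>

definition table_ok :: "(nat \<Rightarrow> nat) \<Rightarrow> nat \<Rightarrow> nat \<Rightarrow> nat \<Rightarrow> (nat \<Rightarrow> nat) \<Rightarrow> (nat \<Rightarrow> nat) \<Rightarrow> (nat \<Rightarrow> nat) \<Rightarrow> bool" where
  "table_ok w B u H F PE PV \<longleftrightarrow> (\<forall>v<n. F v = (if v = u then 0 else B)) \<and>
     (\<forall>h<H. layer_ok w (darts w m) (\<lambda>v. F (h * n + v)) (\<lambda>v. F (Suc h * n + v))
        (\<lambda>v. PE (Suc h * n + v)) (\<lambda>v. PV (Suc h * n + v)))"

text \<open>The Bellman-Ford argument, peeling off the first edge: no walk with at most
  \<open>h\<close> edges is lighter than the entry in layer \<open>h\<close>. That finite entries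
  are attained is shown separately, by tracing parents in \<open>wp_extractP\<close>.\<close>

lemma table_ok_lower:
  assumes T: "table_ok w B u H F PE PV" and "h \<le> H" "joins en v es u" "set es \<subseteq> support w"
    "length es \<le> h" "v < n"
  shows "F (h * n + v) \<le> (\<Sum>e\<leftarrow>es. w e)"
  using assms(2-)
proof (induction h arbitrary: v es)
  case 0
  then show ?case using T by (simp add: table_ok_def)
next
  case (Suc h)
  have L: "layer_ok w (darts w m) (\<lambda>v. F (h * n + v)) (\<lambda>v. F (Suc h * n + v))
        (\<lambda>v. PE (Suc h * n + v)) (\<lambda>v. PV (Suc h * n + v))"
    using T Suc.prems by (simp add: table_ok_def)
  show ?case
  proof (cases es)
    case Nil
    have "F (Suc h * n + v) \<le> F (h * n + v)"
      using L Suc.prems unfolding layer_ok_def by blast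
    also have "\<dots> \<le> (\<Sum>e\<leftarrow>es. w e)"
      using Suc.prems Nil by (intro Suc.IH) auto
    finally show ?thesis .
  next
    case (Cons e es')
    then obtain x where x: "en e = {v, x}" "joins en x es' u" "e \<in> support w"
      using Suc.prems by auto
    then have dart: "(e, x, v) \<in> darts w m" by (simp add: in_darts_iff insert_commute)
    then have "F (Suc h * n + v) \<le> F (h * n + x) + w e"
      using L unfolding layer_ok_def by blast
    also have "F (h * n + x) \<le> (\<Sum>e\<leftarrow>es'. w e)"
      using Suc.prems x Cons darts_bound[OF dart] by (intro Suc.IH) auto
    finally show ?thesis by (simp add: Cons)
  qed
qed

lemma table_ok_base:
  assumes "table_ok w B u H F PE PV" "v < n" "F v < B"
  shows "v = u" "F v = 0"
  using assms by (auto simp: table_ok_def split: if_splits)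

end

abbreviation "offE \<equiv> var aOFF"
abbreviation "nxtE \<equiv> Add (var aOFF) nE"

definition relaxP :: "expr \<Rightarrow> expr \<Rightarrow> prog" where
  "relaxP a b =
     When (Less (Add (Cell aF (Add offE a)) (Cell aW (var cE))) (Cell aF (Add nxtE b)))
       (Seq (Assign aF (Add nxtE b) (Add (Cell aF (Add offE a)) (Cell aW (var cE))))
       (Seq (Assign aPE (Add nxtE b) (Add (var cE) (Const 1)))
            (Assign aPV (Add nxtE b) a)))"

definition copyP :: prog where
  "copyP = For cV nE
     (Seq (Assign aF (Add nxtE (var cV)) (Cell aF (Add offE (var cV))))
          (Assign aPE (Add nxtE (var cV)) (Const 0)))"

definition relaxallP :: prog where
  "relaxallP = For cE mE (When (Cell aW (var cE))
     (Seq (relaxP (srcE (var cE)) (dstE (var cE))) (relaxP (dstE (var cE)) (srcE (var cE)))))"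

definition tableP :: prog where
  "tableP =
     Seq (For cV nE (Assign aF (var cV) (var aBIG)))
    (Seq (Assign aF (var cU) (Const 0))
    (Seq (setv aOFF (Const 0))
         (For cH (var aDD) (Seq copyP (Seq relaxallP (setv aOFF nxtE))))))"

lemma mods_relaxP [simp]: "mods (relaxP a b) = {aF, aPE, aPV}"
  by (auto simp: relaxP_def)
lemma mods_copyP [simp]: "mods copyP = {cV, aF, aPE}"
  by (auto simp: copyP_def)
lemma mods_relaxallP [simp]: "mods relaxallP = {cE, aF, aPE, aPV}"
  by (auto simp: relaxallP_def)
lemma mods_tableP [simp]: "mods tableP = {cV, cE, cH, aF, aPE, aPV, aOFF}"
  by (auto simp: tableP_def)

context ram_input
begin

text \<open>The assumptions quantified over \<open>s'\<close> say that the end expressions depend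
  only on the input and on \<open>cE\<close>, so they keep their values while the table is written.
  This covers \<open>srcE\<close> and \<open>dstE\<close> in either order.\<close>

lemma wp_relaxP:
  assumes "s 0 = g" "s aW = w" "s cE 0 = e" "s aOFF 0 = off"
    and "eval_expr a s = x" "\<And>s'. s' 0 = s 0 \<Longrightarrow> s' cE = s cE \<Longrightarrow> eval_expr a s' = x"
    and "eval_expr b s = y" "\<And>s'. s' 0 = s 0 \<Longrightarrow> s' cE = s cE \<Longrightarrow> eval_expr b s' = y"
    and "e \<in> support w" "en e = {x, y}" "x < n"
    and "layer_ok w X Fp (\<lambda>v. s aF (off + n + v)) (\<lambda>v. s aPE (off + n + v)) (\<lambda>v. s aPV (off + n + v))"
    and "\<And>v. v < n \<Longrightarrow> s aF (off + v) = Fp v"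
  shows "wp N (relaxP a b) (\<lambda>s'.
    layer_ok w (insert (e, x, y) X) Fp (\<lambda>v. s' aF (off + n + v)) (\<lambda>v. s' aPE (off + n + v)) (\<lambda>v. s' aPV (off + n + v)) \<and>
    (\<forall>i<off + n. s' aF i = s aF i \<and> s' aPE i = s aPE i \<and> s' aPV i = s aPV i)) s"
proof -
  have relax: "layer_ok w (insert (e, x, y) X) Fp (\<lambda>v. if v = y then Fp x + w e else s aF (off + n + v))
      (\<lambda>v. if v = y then Suc e else s aPE (off + n + v)) (\<lambda>v. if v = y then x else s aPV (off + n + v))"
    if "Fp x + w e < s aF (off + n + y)"
    using layer_ok_relax[OF assms(12,9,10,11) that] by (simp add: fun_upd_def)
  have keep: "layer_ok w (insert (e, x, y) X) Fp (\<lambda>v. s aF (off + n + v))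
      (\<lambda>v. s aPE (off + n + v)) (\<lambda>v. s aPV (off + n + v))"
    if "\<not> Fp x + w e < s aF (off + n + y)"
    using layer_ok_keep[OF assms(12) that] .
  show ?thesis
    unfolding relaxP_def
    apply (intro wp_When wp_Seq wp_Assign)
    using assms(1-8,11,13) relax apply simp
    using assms(1-8,11,13) keep apply simp
    done
qed

lemma wp_copyP:
  assumes "s 0 = g" "s aOFF 0 = off"
  shows "wp N copyP (\<lambda>s'.
    layer_ok w {} (\<lambda>v. s aF (off + v)) (\<lambda>v. s' aF (off + n + v)) (\<lambda>v. s' aPE (off + n + v)) (\<lambda>v. s' aPV (off + n + v)) \<and>
    (\<forall>i<off + n. s' aF i = s aF i \<and> s' aPE i = s aPE i \<and> s' aPV i = s aPV i)) s"
  unfolding copyP_def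
proof (rule wp_For[where hi = n and I = "\<lambda>j s'.
      (\<forall>i<off + n. s' aF i = s aF i \<and> s' aPE i = s aPE i \<and> s' aPV i = s aPV i) \<and>
      (\<forall>v<j. s' aF (off + n + v) = s aF (off + v) \<and> s' aPE (off + n + v) = 0)"], goal_cases)
  case (2 s')
  then show ?case using assms by (simp add: frameD)
next
  case (5 j s')
  then have "s' 0 = g" "s' aOFF 0 = off" using assms by (simp_all add: frameD)
  then show ?case using 5
    apply (intro wp_Seq wp_Assign)
    apply (simp add: less_Suc_eq)
    done
next
  case (6 s')
  then show ?case by (simp add: layer_ok_def)
qed (use n_le in simp_all)

end

context ram_input
begin

lemma wp_relaxallP:
  assumes s: "s 0 = g" "s aW = w" "s aOFF 0 = off"
    and L: "layer_ok w {} Fp (\<lambda>v. s aF (off + n + v)) (\<lambda>v. s aPE (off + n + v)) (\<lambda>v. s aPV (off + n + v))"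
    and Fp: "\<And>v. v < n \<Longrightarrow> s aF (off + v) = Fp v"
  shows "wp N relaxallP (\<lambda>s'.
    layer_ok w (darts w m) Fp (\<lambda>v. s' aF (off + n + v)) (\<lambda>v. s' aPE (off + n + v)) (\<lambda>v. s' aPV (off + n + v)) \<and>
    (\<forall>i<off + n. s' aF i = s aF i \<and> s' aPE i = s aPE i \<and> s' aPV i = s aPV i)) s"
  unfolding relaxallP_def
proof (rule wp_For[where hi = m and I = "\<lambda>j s'.
      layer_ok w (darts w j) Fp (\<lambda>v. s' aF (off + n + v)) (\<lambda>v. s' aPE (off + n + v)) (\<lambda>v. s' aPV (off + n + v)) \<and>
      (\<forall>i<off + n. s' aF i = s aF i \<and> s' aPE i = s aPE i \<and> s' aPV i = s aPV i)"], goal_cases)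
  case (2 s')
  then show ?case using s by (simp add: frameD)
next
  case (5 j s')
  then have s': "s' 0 = g" "s' aW = w" "s' cE 0 = j" "s' aOFF 0 = off" using s by (simp_all add: frameD)
  have L: "layer_ok w (darts w j) Fp (\<lambda>v. s' aF (off + n + v)) (\<lambda>v. s' aPE (off + n + v)) (\<lambda>v. s' aPV (off + n + v))"
    and low: "\<And>i. i < off + n \<Longrightarrow> s' aF i = s aF i \<and> s' aPE i = s aPE i \<and> s' aPV i = s aPV i"
    using 5 by auto
  note j = \<open>j < m\<close>
  show ?case
  proof (intro wp_When wp_Seq)
    assume "eval_expr (Cell aW (var cE)) s' \<noteq> 0"
    then have wj: "w j \<noteq> 0" "j \<in> support w" using s' j by (auto simp: support_def)
    show "wp N (relaxP (srcE (var cE)) (dstE (var cE)))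
         (wp N (relaxP (dstE (var cE)) (srcE (var cE)))
           (\<lambda>a. layer_ok w (darts w (Suc j)) Fp
                  (\<lambda>v. store a cE 0 (Suc j) aF (off + n + v))
                  (\<lambda>v. store a cE 0 (Suc j) aPE (off + n + v))
                  (\<lambda>v. store a cE 0 (Suc j) aPV (off + n + v)) \<and>
                 (\<forall>i<off + n.
                     store a cE 0 (Suc j) aF i = s aF i \<and>
                     store a cE 0 (Suc j) aPE i = s aPE i \<and>
                     store a cE 0 (Suc j) aPV i = s aPV i))) s'"
    proof (rule wp_conseq[OF wp_relaxP[OF s' _ _ _ _ wj(2) _ _ L, of _ "src_of g j" _ "dst_of g j"]], goal_cases)
      case (8 s1)
      have s1: "s1 0 = g" "s1 aW = w" "s1 cE 0 = j" "s1 aOFF 0 = off"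
        using s' 8(1) by (simp_all add: frameD)
      show ?case
      proof (rule wp_conseq[OF wp_relaxP[OF s1 _ _ _ _ wj(2) _ _ 8(2)[THEN conjunct1], of _ "dst_of g j" _ "src_of g j"]], goal_cases)
        case (8 s2)
        then show ?case using \<open>_ \<and> (\<forall>i<off + n. s1 aF i = s' aF i \<and> _ i)\<close> low wj j by (simp add: darts_Suc)
      qed (use s1 8 en j src dst Fp low in \<open>auto simp: insert_commute\<close>)
    qed (use s' en j src dst Fp low in auto)
  next
    assume "eval_expr (Cell aW (var cE)) s' = 0"
    then show "layer_ok w (darts w (Suc j)) Fp
         (\<lambda>v. store s' cE 0 (Suc j) aF (off + n + v))
         (\<lambda>v. store s' cE 0 (Suc j) aPE (off + n + v))
         (\<lambda>v. store s' cE 0 (Suc j) aPV (off + n + v)) \<and>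
        (\<forall>i<off + n.
            store s' cE 0 (Suc j) aF i = s aF i \<and>
            store s' cE 0 (Suc j) aPE i = s aPE i \<and>
            store s' cE 0 (Suc j) aPV i = s aPV i)"
      using L low s' by (simp add: darts_Suc_zero)
  qed
next
  case (6 s')
  then show ?case by blast
qed (use bounds L in simp_all)

lemma table_ok_Suc:
  assumes T: "table_ok w B u h F PE PV"
    and low: "\<And>i. i < h * n + n \<Longrightarrow> F' i = F i \<and> PE' i = PE i \<and> PV' i = PV i"
    and L: "layer_ok w (darts w m) (\<lambda>v. F (h * n + v)) (\<lambda>v. F' (h * n + n + v))
      (\<lambda>v. PE' (h * n + n + v)) (\<lambda>v. PV' (h * n + n + v))"
  shows "table_ok w B u (Suc h) F' PE' PV'"
  unfolding table_ok_def
proof (intro conjI allI impI)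
  fix v assume "v < n"
  then show "F' v = (if v = u then 0 else B)"
    using T low[of v] by (simp add: table_ok_def)
next
  fix i assume i: "i < Suc h"
  show "layer_ok w (darts w m) (\<lambda>v. F' (i * n + v)) (\<lambda>v. F' (Suc i * n + v))
      (\<lambda>v. PE' (Suc i * n + v)) (\<lambda>v. PV' (Suc i * n + v))"
  proof (cases "i = h")
    case True
    show ?thesis
      by (rule layer_ok_cong[OF L]) (use low in \<open>simp_all add: True algebra_simps\<close>)
  next
    case False
    then have "Suc i * n \<le> h * n" using i by (intro mult_le_mono1) simp
    then have eq: "F' (Suc i * n + v) = F (Suc i * n + v) \<and> PE' (Suc i * n + v) = PE (Suc i * n + v) \<and>
        PV' (Suc i * n + v) = PV (Suc i * n + v) \<and> F' (i * n + v) = F (i * n + v)" if "v < n" for v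
      using low[of "Suc i * n + v"] low[of "i * n + v"] that by simp
    have "layer_ok w (darts w m) (\<lambda>v. F (i * n + v)) (\<lambda>v. F (Suc i * n + v))
      (\<lambda>v. PE (Suc i * n + v)) (\<lambda>v. PV (Suc i * n + v))"
      using T i False by (simp add: table_ok_def)
    then show ?thesis by (rule layer_ok_cong) (use eq in blast)+
  qed
qed

lemma wp_tableP:
  assumes s: "s 0 = g" "s aW = w" "s cU 0 = u" "u < n" "s aDD 0 = H" "H \<le> N" "s aBIG 0 = B"
  shows "wp N tableP (\<lambda>s'. table_ok w B u H (s' aF) (s' aPE) (s' aPV) \<and> s' aOFF 0 = H * n) s"
  unfolding tableP_def
proof (rule wp_Seq, rule wp_For[where hi = n and I = "\<lambda>j s'. \<forall>v<j. s' aF v = B"], goal_cases)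
  case (2 s')
  then show ?case using s by (simp add: frameD)
next
  case (5 j s')
  then have "s' aBIG 0 = B" using s by (simp add: frameD)
  with 5 show ?case by (intro wp_Assign) (simp add: less_Suc_eq)
next
  case (6 s1)
  have s1: "s1 0 = g" "s1 aW = w" "s1 cU 0 = u" "s1 aDD 0 = H"
    using s 6(1) by (simp_all add: frameD)
  show ?case
  proof (intro wp_Seq wp_Assign, rule wp_For[where hi = H and I = "\<lambda>h s'.
        table_ok w B u h (s' aF) (s' aPE) (s' aPV) \<and> s' aOFF 0 = h * n"], goal_cases)
    case (2 s')
    then show ?case using s1 by (simp add: frameD)
  next
    case (4)
    show ?case using s1 6(2) \<open>u < n\<close> by (simp add: table_ok_def)
  next
    case (5 h s2)
    have s2: "s2 0 = g" "s2 aW = w" "s2 aOFF 0 = h * n"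
      using s1 5(3,4) by (simp_all add: frameD)
    show ?case
    proof (intro wp_Seq, rule wp_conseq[OF wp_copyP[OF s2(1,3), where w = w]], goal_cases)
      case (1 s3)
      have s3: "s3 0 = g" "s3 aW = w" "s3 aOFF 0 = h * n"
        using s2 1(1) by (simp_all add: frameD)
      show ?case
      proof (rule wp_Seq, rule wp_conseq[OF wp_relaxallP[OF s3 1(2)[THEN conjunct1]]], goal_cases)
        case (1 v)
        then show ?case using \<open>_ \<and> (\<forall>i<h * n + n. s3 aF i = s2 aF i \<and> _ i)\<close> by simp
      next
        case (2 s4)
        have s4: "s4 0 = g" "s4 aOFF 0 = h * n"
          using s3 2(1) by (simp_all add: frameD)
        have "table_ok w B u (Suc h) (s4 aF) (s4 aPE) (s4 aPV)"
          by (rule table_ok_Suc[OF 5(4)[THEN conjunct1] _ 2(2)[THEN conjunct1]])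
            (use 1(2) 2(2) in auto)
        then show ?case using s4 by (intro wp_Assign) (simp add: add.commute)
      qed
    qed
  next
    case (6 s')
    then show ?case by blast
  qed (use s in simp_all)
qed (use n_le in simp_all)

lemma table_ok_back:
  assumes "table_ok w B u H F PE PV" "h < H" "x < n"
  shows "PE (Suc h * n + x) = 0 \<and> F (Suc h * n + x) = F (h * n + x) \<or>
    (\<exists>e\<in>support w. PE (Suc h * n + x) = Suc e \<and> PV (Suc h * n + x) < n \<and> en e = {x, PV (Suc h * n + x)} \<and>
       F (Suc h * n + x) = F (h * n + PV (Suc h * n + x)) + w e)"
proof -
  have "layer_ok w (darts w m) (\<lambda>v. F (h * n + v)) (\<lambda>v. F (Suc h * n + v))
      (\<lambda>v. PE (Suc h * n + v)) (\<lambda>v. PV (Suc h * n + v))"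
    using assms(1,2) by (simp add: table_ok_def)
  then show ?thesis using assms(3) unfolding layer_ok_def by blast
qed

end

section \<open>Tracing a walk back through the table\<close>

definition extractP :: prog where
  "extractP =
     Seq (For cE mE (Assign aPS (var cE) (Const 0)))
    (Seq (setv aX (var cV))
    (Seq (setv aO (var aOFF))
    (For cH (var aDD)
      (Seq (When (Cell aPE (Add (var aO) (var aX)))
             (Seq (Assign aPS (Sub (Cell aPE (Add (var aO) (var aX))) (Const 1)) (Const 1))
                  (setv aX (Cell aPV (Add (var aO) (var aX))))))
           (setv aO (Sub (var aO) nE))))))"

lemma mods_extractP [simp]: "mods extractP = {cE, cH, aPS, aX, aO}"
  by (auto simp: extractP_def)

context ram_input
begin

text \<open>\<open>c\<close> counts repeated edges of the walk, while the marks in \<open>PS\<close>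
  record only its edge set; \<open>sum_set_le_sum_list\<close> later compares the two
  weights.\<close>

definition linked :: "(nat \<Rightarrow> nat) \<Rightarrow> nat \<Rightarrow> nat \<Rightarrow> nat \<Rightarrow> nat \<Rightarrow> (nat \<Rightarrow> nat) \<Rightarrow> bool" where
  "linked w H c u v PS \<longleftrightarrow> (\<exists>es. joins en v es u \<and> set es \<subseteq> support w \<and> length es \<le> H \<and>
     (\<Sum>e\<leftarrow>es. w e) = c \<and> support PS = set es)"

lemma linked_snoc:
  assumes "linked w j c x v PS" "en e = {x, y}" "e \<in> support w"
  shows "linked w (Suc j) (w e + c) y v (PS(e := 1))"
proof -
  obtain es where "joins en v es x" "set es \<subseteq> support w" "length es \<le> j"
     "(\<Sum>e\<leftarrow>es. w e) = c" "support PS = set es"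
    using assms(1) unfolding linked_def by blast
  moreover have "support (PS(e := 1)) = insert e (support PS)"
    using assms(3) by (auto simp: support_def)
  ultimately show ?thesis
    unfolding linked_def using assms(2,3) by (intro exI[of _ "es @ [e]"]) (auto simp: joins_append)
qed

lemma linked_mono: "linked w j c u v PS \<Longrightarrow> j \<le> j' \<Longrightarrow> linked w j' c u v PS"
  unfolding linked_def using le_trans by blast

lemma wp_extractP:
  assumes s: "s 0 = g" "s aOFF 0 = H * n" "s cV 0 = v" "v < n" "s aDD 0 = H" "H \<le> N"
    and T: "table_ok w B u H (s aF) (s aPE) (s aPV)" and less: "s aF (H * n + v) < B"
  shows "wp N extractP (\<lambda>s'. linked w H (s aF (H * n + v)) u v (s' aPS)) s"
  unfolding extractP_def
proof (rule wp_Seq, rule wp_For[where hi = m and I = "\<lambda>j s'. \<forall>e<j. s' aPS e = 0"], goal_cases)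
  case (2 s')
  then show ?case using s by (simp add: frameD)
next
  case (5 j s')
  then show ?case by (intro wp_Assign) (simp add: less_Suc_eq)
next
  case (6 s1)
  have s1: "s1 0 = g" "s1 aOFF 0 = H * n" "s1 cV 0 = v" "s1 aDD 0 = H" "s1 aF = s aF" "s1 aPE = s aPE"
      "s1 aPV = s aPV"
    using s 6(1) by (simp_all add: frameD)
  show ?case
  \<comment> \<open>After \<open>j\<close> steps the trace stands at \<open>aX\<close> in layer
    \<open>H - j\<close>; the weight collected so far plus the entry there is the entry it started
    from.\<close>
  proof (intro wp_Seq wp_Assign, rule wp_For[where hi = H and I = "\<lambda>j s'. s' aO 0 = (H - j) * n \<and> s' aX 0 < n \<and>
      (\<exists>c. linked w j c (s' aX 0) v (s' aPS) \<and> s aF (H * n + v) = s aF ((H - j) * n + s' aX 0) + c)"], goal_cases)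
    case (2 s')
    then show ?case using s1 by (simp add: frameD)
  next
    case 4
    have "support (s1 aPS) = {}" using 6(2) by (auto simp: support_def)
    then have "linked w 0 0 v v (s1 aPS)"
      unfolding linked_def by (intro exI[of _ "[]"]) auto
    then show ?case using s1 \<open>v < n\<close> by simp
  next
    case (5 j s2)
    have s2: "s2 0 = g" "s2 aPE = s aPE" "s2 aPV = s aPV" using s1 5(3) by (simp_all add: frameD)
    obtain h where h: "H - j = Suc h" "h < H" "H - Suc j = h"
      using 5(1) by (metis Suc_diff_Suc diff_less_Suc diff_le_self less_Suc_eq_le less_le_trans not_less_eq)
    define x where "x = s2 aX 0"
    obtain c where c: "linked w j c x v (s2 aPS)" "s aF (H * n + v) = s aF (Suc h * n + x) + c"
        "x < n" "s2 aO 0 = Suc h * n"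
      using 5(4) h by (auto simp: x_def)
    show ?case
    proof (intro wp_Seq wp_When wp_Assign, goal_cases)
      case 1
      then have "s aPE (Suc h * n + x) \<noteq> 0" using s2 c by (simp add: x_def)
      then obtain e where e: "e \<in> support w" "s aPE (Suc h * n + x) = Suc e" "s aPV (Suc h * n + x) < n"
          "en e = {x, s aPV (Suc h * n + x)}"
          "s aF (Suc h * n + x) = s aF (h * n + s aPV (Suc h * n + x)) + w e"
        using table_ok_back[OF T h(2) c(3)] by auto
      show ?case
        using linked_snoc[OF c(1) e(4,1)] e c s2 h
        by (auto simp: x_def fun_upd_def intro!: exI[of _ "w e + c"])
    next
      case 2
      then have "s aPE (Suc h * n + x) = 0" using s2 c by (simp add: x_def)
      then have "s aF (Suc h * n + x) = s aF (h * n + x)"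
        using table_ok_back[OF T h(2) c(3)] by auto
      then show ?case
        using linked_mono[OF c(1), of "Suc j"] c s2 h by (auto simp: x_def)
    qed
  next
    case (6 s')
    then obtain c where c: "linked w H c (s' aX 0) v (s' aPS)" "s aF (H * n + v) = s aF (s' aX 0) + c" "s' aX 0 < n"
      by auto
    \<comment> \<open>The entry reached in layer 0 is at most the initial one, hence below
      \<open>B\<close>, and only the source has such an entry in layer 0.\<close>
    then have "s' aX 0 = u" "s aF (s' aX 0) = 0"
      using table_ok_base[OF T c(3)] less by auto
    then show ?case using c by simp
  qed (use s in simp_all)
qed (use bounds in simp_all)

end

section \<open>Merging the closest clusters\<close>

text \<open>A walk is extracted as soon as it improves the best value, because the table is
  overwritten for the next source.\<close>

definition searchP :: prog where
  "searchP = For cV nE (When (Cell aSZ (var cV)) (Cond (eqE (var cV) (var cU)) Skip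
     (When (Less (Cell aF (Add offE (var cV))) (var aBEST))
       (Seq (setv aBEST (Cell aF (Add offE (var cV))))
       (Seq (setv aBU (var cU))
       (Seq (setv aBV (var cV))
            extractP))))))"

definition closestP :: prog where
  "closestP = Seq (setv aBEST (var aBIG)) (For cU nE (When (Cell aSZ (var cU)) (Seq tableP searchP)))"

definition joinP :: prog where
  "joinP = Cond (Less (Cell aSZ (var aBU)) (Cell aSZ (var aBV)))
     (Seq (Assign aSZ (var aBV) (Add (Cell aSZ (var aBU)) (Cell aSZ (var aBV))))
          (Assign aSZ (var aBU) (Const 0)))
     (Seq (Assign aSZ (var aBU) (Add (Cell aSZ (var aBV)) (Cell aSZ (var aBU))))
          (Assign aSZ (var aBV) (Const 0)))"

definition addpathP :: prog where
  "addpathP = For cE mE (When (Cell aPS (var cE)) (Assign aH (var cE) (Const 1)))"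

definition mergeP :: prog where
  "mergeP = Seq closestP (Seq joinP addpathP)"

lemma mods_searchP [simp]: "mods searchP = {cV, cE, cH, aPS, aX, aO, aBEST, aBU, aBV}"
  by (auto simp: searchP_def)
lemma mods_closestP [simp]:
  "mods closestP = {cU, cV, cE, cH, aF, aPE, aPV, aOFF, aPS, aX, aO, aBEST, aBU, aBV}"
  by (auto simp: closestP_def)
lemma mods_joinP [simp]: "mods joinP = {aSZ}"
  by (auto simp: joinP_def)
lemma mods_addpathP [simp]: "mods addpathP = {cE, aH}"
  by (auto simp: addpathP_def)
lemma mods_mergeP [simp]:
  "mods mergeP = {cU, cV, cE, cH, aF, aPE, aPV, aOFF, aPS, aX, aO, aBEST, aBU, aBV, aSZ, aH}"
  by (auto simp: mergeP_def)

context ram_input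
begin

definition terminals :: "(nat \<Rightarrow> nat) \<Rightarrow> nat set" where
  "terminals sz = {v. v < n \<and> sz v \<noteq> 0}"

definition separated :: "(nat \<Rightarrow> nat) \<Rightarrow> nat \<Rightarrow> nat \<Rightarrow> nat \<Rightarrow> nat \<Rightarrow> bool" where
  "separated w H c u v \<longleftrightarrow> (\<forall>es. joins en v es u \<longrightarrow> set es \<subseteq> support w \<longrightarrow> length es \<le> H \<longrightarrow> c \<le> (\<Sum>e\<leftarrow>es. w e))"

text \<open>\<open>X\<close> is the set of ordered pairs inspected so far, and \<open>c = B\<close>
  means that no pair has been linked yet.\<close>

definition closest :: "(nat \<Rightarrow> nat) \<Rightarrow> (nat \<Rightarrow> nat) \<Rightarrow> nat \<Rightarrow> nat \<Rightarrow> (nat \<times> nat) set \<Rightarrow>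
    nat \<Rightarrow> nat \<Rightarrow> nat \<Rightarrow> (nat \<Rightarrow> nat) \<Rightarrow> bool" where
  "closest w sz H B X c bu bv PS \<longleftrightarrow> c \<le> B \<and> (\<forall>(u, v)\<in>X. separated w H c u v) \<and>
     (c < B \<longrightarrow> bu \<in> terminals sz \<and> bv \<in> terminals sz \<and> bu \<noteq> bv \<and> linked w H c bu bv PS)"

lemma separated_mono: "separated w H c u v \<Longrightarrow> c' \<le> c \<Longrightarrow> separated w H c' u v"
  unfolding separated_def using le_trans by blast

lemma closest_keep:
  "closest w sz H B X c bu bv PS \<Longrightarrow> separated w H c u v \<Longrightarrow> closest w sz H B (insert (u, v) X) c bu bv PS"
  unfolding closest_def by auto

lemma closest_update:
  assumes "closest w sz H B X c bu bv PS" "separated w H c' u v" "c' < c"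
    "u \<in> terminals sz" "v \<in> terminals sz" "u \<noteq> v" "linked w H c' u v PS'"
  shows "closest w sz H B (insert (u, v) X) c' u v PS'"
  using assms separated_mono[of w H c _ _ c'] unfolding closest_def by auto

lemma wp_searchP:
  assumes s: "s 0 = g" "s aSZ = sz" "s aOFF 0 = H * n" "s cU 0 = u" "u \<in> terminals sz"
      "s aDD 0 = H" "H \<le> N"
    and T: "table_ok w B u H (s aF) (s aPE) (s aPV)"
    and C: "closest w sz H B X (s aBEST 0) (s aBU 0) (s aBV 0) (s aPS)"
  shows "wp N searchP (\<lambda>s'. closest w sz H B (X \<union> {u} \<times> (terminals sz - {u}))
    (s' aBEST 0) (s' aBU 0) (s' aBV 0) (s' aPS)) s"
  unfolding searchP_def
proof (rule wp_For[where hi = n and I = "\<lambda>j s'. closest w sz H B (X \<union> {u} \<times> ({v. v < j} \<inter> (terminals sz - {u})))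
    (s' aBEST 0) (s' aBU 0) (s' aBV 0) (s' aPS)"], goal_cases)
  case (2 s')
  then show ?case using s by (simp add: frameD)
next
  case 4
  then show ?case using C by simp
next
  case (5 j s')
  have s': "s' 0 = g" "s' aSZ = sz" "s' aOFF 0 = H * n" "s' cU 0 = u" "s' aDD 0 = H" "s' aF = s aF"
      "s' aPE = s aPE" "s' aPV = s aPV" "s' cV 0 = j"
    using s 5(2,3) by (simp_all add: frameD)
  let ?X = "X \<union> {u} \<times> ({v. v < j} \<inter> (terminals sz - {u}))"
    and ?X' = "X \<union> {u} \<times> ({v. v < Suc j} \<inter> (terminals sz - {u}))"
  have same: "?X' = ?X" if "j \<notin> terminals sz \<or> j = u"
    using that by (auto simp: less_Suc_eq)
  have new: "?X' = insert (u, j) ?X" if "j \<in> terminals sz" "j \<noteq> u"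
    using that by (auto simp: less_Suc_eq)
  have sep: "separated w H (s aF (H * n + j)) u j"
    unfolding separated_def using table_ok_lower[OF T order_refl] 5(1) by blast
  show ?case
  proof (intro wp_When wp_Cond wp_Skip wp_Seq wp_Assign, goal_cases)
    case 1
    then show ?case using same 5(4) s' by simp
  next
    case 2
    then have j: "j \<in> terminals sz" "j \<noteq> u" and less: "s aF (H * n + j) < s' aBEST 0"
      using s' 5(1) by (auto simp: terminals_def split: if_splits)
    have B: "s aF (H * n + j) < B"
      using less 5(4) unfolding closest_def by simp
    show ?case
    proof (rule wp_conseq[OF wp_extractP[where H = H and v = j and u = u and B = B and w = w]], goal_cases)
      case (9 s2)
      have "closest w sz H B ?X' (s aF (H * n + j)) u j (s2 aPS)"
        unfolding new[OF j]
        by (rule closest_update[OF 5(4) sep less s(5) j(1) j(2)[symmetric]]) (use 9(2) s' in simp)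
      moreover have "s2 aBEST 0 = s aF (H * n + j)" "s2 aBU 0 = u" "s2 aBV 0 = j"
        using 9(1) s' by (simp_all add: frameD)
      ultimately show ?case by simp
    qed (use s' s(7) 5(1) T B in simp_all)
  next
    case 3
    then have j: "j \<in> terminals sz" "j \<noteq> u" and "s' aBEST 0 \<le> s aF (H * n + j)"
      using s' 5(1) by (auto simp: terminals_def split: if_splits)
    then show ?case
      using closest_keep[OF 5(4)] separated_mono[OF sep] new by simp
  next
    case 4
    then have "j \<notin> terminals sz" using s' by (simp add: terminals_def)
    then show ?case using same 5(4) by simp
  qed
next
  case (6 s')
  have "{v. v < n} \<inter> (terminals sz - {u}) = terminals sz - {u}" by (auto simp: terminals_def)
  then show ?case using 6 by simp
qed (use n_le in simp_all)

definition all_pairs :: "(nat \<Rightarrow> nat) \<Rightarrow> nat \<Rightarrow> (nat \<times> nat) set" where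
  "all_pairs sz j = {(u, v). u < j \<and> u \<in> terminals sz \<and> v \<in> terminals sz \<and> u \<noteq> v}"

lemma wp_closestP:
  assumes s: "s 0 = g" "s aW = w" "s aSZ = sz" "s aDD 0 = H" "H \<le> N" "s aBIG 0 = B"
  shows "wp N closestP (\<lambda>s'. closest w sz H B (all_pairs sz n) (s' aBEST 0) (s' aBU 0) (s' aBV 0) (s' aPS)) s"
  unfolding closestP_def
proof (intro wp_Seq wp_Assign, rule wp_For[where hi = n and I = "\<lambda>j s'. closest w sz H B (all_pairs sz j)
    (s' aBEST 0) (s' aBU 0) (s' aBV 0) (s' aPS)"], goal_cases)
  case (2 s')
  then show ?case using s by (simp add: frameD)
next
  case 4
  show ?case using s by (simp add: closest_def all_pairs_def)
next
  case (5 u s')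
  have s': "s' 0 = g" "s' aW = w" "s' aSZ = sz" "s' aDD 0 = H" "s' cU 0 = u" "s' aBIG 0 = B"
    using s 5(2,3) by (simp_all add: frameD)
  show ?case
  proof (intro wp_When wp_Seq, goal_cases)
    case 1
    then have u: "u \<in> terminals sz" using s' 5(1) by (simp add: terminals_def)
    have pairs: "all_pairs sz (Suc u) = all_pairs sz u \<union> {u} \<times> (terminals sz - {u})"
      using u by (auto simp: all_pairs_def less_Suc_eq)
    show ?case
    proof (rule wp_conseq[OF wp_tableP[OF s'(1,2,5) 5(1) s'(4) s(5) s'(6)]], goal_cases)
      case (1 s1)
      have s1: "s1 0 = g" "s1 aSZ = sz" "s1 aDD 0 = H" "s1 cU 0 = u" "s1 aBEST = s' aBEST"
          "s1 aBU = s' aBU" "s1 aBV = s' aBV" "s1 aPS = s' aPS"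
        using s' 1(1) by (simp_all add: frameD)
      show ?case
        by (rule wp_conseq[OF wp_searchP[where X = "all_pairs sz u"]])
          (use s1 u 1(2) s(5) 5(4) pairs in simp_all)
    qed
  next
    case 2
    then have "all_pairs sz (Suc u) = all_pairs sz u"
      using s' by (auto simp: all_pairs_def terminals_def less_Suc_eq)
    then show ?case using 5(4) by simp
  qed
qed (use n_le in simp_all)

lemma wp_addpathP:
  assumes s: "s 0 = g"
  shows "wp N addpathP (\<lambda>s'. support (s' aH) = support (s aH) \<union> support (s aPS)) s"
  unfolding addpathP_def
proof (rule wp_For[where hi = m and I = "\<lambda>j s'. \<forall>e. s' aH e \<noteq> 0 \<longleftrightarrow> s aH e \<noteq> 0 \<or> e < j \<and> s aPS e \<noteq> 0"], goal_cases)
  case (2 s')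
  then show ?case using s by (simp add: frameD)
next
  case (5 j s')
  then have "s' aPS = s aPS" by (simp add: frameD)
  then show ?case using 5(2,4) by (intro wp_When wp_Assign) (auto simp: less_Suc_eq)
next
  case (6 s')
  then show ?case by (auto simp: support_def)
qed (use bounds in simp_all)

lemma wp_joinP:
  assumes "s aSZ = sz" "s aBU 0 = u" "s aBV 0 = v" "u \<noteq> v"
    and "sz u \<le> sz v \<Longrightarrow> Q (sz(v := sz u + sz v, u := 0))"
    and "sz v \<le> sz u \<Longrightarrow> Q (sz(u := sz v + sz u, v := 0))"
  shows "wp N joinP (\<lambda>s'. Q (s' aSZ)) s"
  unfolding joinP_def using assms by (intro wp_Cond wp_Seq wp_Assign) simp_all

end

section \<open>The cost of successive merges\<close>

lemma sum_set_le_sum_list: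
  fixes w :: "'e \<Rightarrow> nat"
  shows "sum w (set es) \<le> (\<Sum>e\<leftarrow>es. w e)"
  by (induction es) (auto simp: sum.insert_if)

lemma finite_active_edges [simp]: "finite (active_edges en m k)"
  by (auto simp: active_edges_def)

text \<open>Capping \<open>D\<close> at the number of vertices keeps the tables polynomial although
  \<open>D\<close> is given in binary; a path has fewer edges than the graph has vertices, so
  \<open>k\<close>-fold linkage is preserved.\<close>

locale connected_input = ram_input +
  fixes d :: nat
  assumes d: "d = min (g 0) (g 2)"
    and pos: "0 < g 1" "0 < g 2"
    and link: "u < g 2 \<Longrightarrow> v < g 2 \<Longrightarrow> u \<noteq> v \<Longrightarrow> \<exists>P. link_system en (active_edges en (g 3) (g 1)) (g 1) d u v P"
begin

abbreviation (input) "active \<equiv> active_edges en m k"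

text \<open>The state after \<open>r\<close> merges. The sizes sum to \<open>n\<close>, which will
  bound the exponents in \<open>clustered\<close> by \<open>log 2 n\<close>. The harmonic difference
  is the sum of \<open>1 / s\<close> over the numbers \<open>s = n, ..., n - r + 1\<close> of
  centers before each merge.\<close>

definition forest :: "(nat \<Rightarrow> nat) \<Rightarrow> nat \<Rightarrow> (nat \<Rightarrow> nat) \<Rightarrow> (nat \<Rightarrow> nat) \<Rightarrow> bool" where
  "forest w r sz F \<longleftrightarrow> card (terminals sz) = n - r \<and> sum sz {..<n} = n \<and>
     clustered en (support F) {..<n} (2 * d) sz \<and> support F \<subseteq> support w \<and>
     real (sum w (support F)) * real k \<le> 4 * real (sum w active) * (harm n - harm (n - r))"

lemma finite_support [simp]: "finite (support w)"
  by (auto simp: support_def)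

lemma finite_terminals [simp]: "finite (terminals sz)"
  by (auto simp: terminals_def)

lemma card_en: "e < m \<Longrightarrow> card (en e) = 2"
  using en loopless by simp

text \<open>A single path of a link system has distinct edges and so weighs at most the whole active
  graph, which is below \<open>B\<close>. Hence a pair is always found, and the minimum obeys the
  ball-packing bound.\<close>

lemma closest_bound:
  assumes C: "closest w sz (2 * d) B (all_pairs sz n) c bu bv PS"
    and w: "support w = active" "sum w active < B" and card: "2 \<le> card (terminals sz)"
  shows "c < B" "card (terminals sz) * k * c \<le> 4 * sum w active"
proof -
  have sep: "c \<le> (\<Sum>e\<leftarrow>es. w e)" if "s \<in> terminals sz" "t \<in> terminals sz" "s \<noteq> t" "joins en s es t"
    "set es \<subseteq> active" "length es \<le> 2 * d" for s t es
  proof -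
    have "(t, s) \<in> all_pairs sz n" using that by (auto simp: all_pairs_def terminals_def)
    then show ?thesis using C that w(1) unfolding closest_def separated_def by blast
  qed
  have link': "\<exists>P. link_system en active k d s t P" if "s \<in> terminals sz" "t \<in> terminals sz" "s \<noteq> t" for s t
    using link that by (auto simp: terminals_def)
  show "card (terminals sz) * k * c \<le> 4 * sum w active"
    by (rule terminal_distance_bound[where en = en and D = d])
      (use card sep link' card_en in \<open>auto simp: active_edges_def\<close>)
  obtain s t where st: "s \<in> terminals sz" "t \<in> terminals sz" "s \<noteq> t"
    using card by (metis One_nat_def card_le_Suc0_iff_eq finite_terminals not_less_eq_eq numeral_2_eq_2)
  then obtain P where "link_system en active k d s t P" using link' by blast
  then have P: "joins en s (P 0) t" "set (P 0) \<subseteq> active" "length (P 0) \<le> d" "distinct (P 0)"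
    using pos distinct_map by (auto simp: link_system_def)
  have "c \<le> (\<Sum>e\<leftarrow>P 0. w e)" using P by (intro sep[OF st]) auto
  also have "\<dots> = sum w (set (P 0))" using P(4) by (simp add: sum_list_distinct_conv_sum_set)
  also have "\<dots> \<le> sum w active" using P(2) by (intro sum_mono2) auto
  finally show "c < B" using w(2) by simp
qed

lemma forest_merge:
  assumes F: "forest w r sz F" and r: "Suc r < n" and w: "support w = active"
    and bound: "card (terminals sz) * k * c \<le> 4 * sum w active"
    and uv: "u \<in> terminals sz" "v \<in> terminals sz" "u \<noteq> v" "sz u \<le> sz v"
    and p: "joins en u p v" "set p \<subseteq> support w" "length p \<le> 2 * d" "(\<Sum>e\<leftarrow>p. w e) = c"
    and F': "support F' = support F \<union> set p"
  shows "forest w (Suc r) (sz(v := sz u + sz v, u := 0)) F'"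
  unfolding forest_def
proof (intro conjI)
  have cardT: "card (terminals sz) = n - r" using F by (simp add: forest_def)
  have "terminals (sz(v := sz u + sz v, u := 0)) = terminals sz - {u}"
    using uv by (auto simp: terminals_def)
  then show "card (terminals (sz(v := sz u + sz v, u := 0))) = n - Suc r"
    using uv cardT by simp
  show "sum (sz(v := sz u + sz v, u := 0)) {..<n} = n"
    using F uv by (subst sum_merge) (auto simp: forest_def terminals_def)
  show "clustered en (support F') {..<n} (2 * d) (sz(v := sz u + sz v, u := 0))"
    unfolding F' using F uv p by (intro clustered_merge) (auto simp: forest_def terminals_def)
  show "support F' \<subseteq> support w" using F F' p by (auto simp: forest_def)
  have "sum w (support F') \<le> sum w (support F) + sum w (set p)"
    unfolding F' by (rule sum_Un_nat[THEN eq_imp_le, THEN order_trans]) auto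
  then have "sum w (support F') \<le> sum w (support F) + c"
    using sum_set_le_sum_list[of w p] p by simp
  then have "real (sum w (support F')) * real k \<le> real (sum w (support F) + c) * real k"
    by (intro mult_right_mono) (simp_all only: of_nat_le_iff of_nat_0_le_iff)
  also have "\<dots> = real (sum w (support F)) * real k + real c * real k"
    by (simp add: algebra_simps)
  \<comment> \<open>The second summand pays for the merge with \<open>n - r\<close> centers left; it
    is the next harmonic increment.\<close>
  also have "\<dots> \<le> 4 * real (sum w active) * (harm n - harm (n - r)) + 4 * real (sum w active) / real (n - r)"
  proof (rule add_mono)
    show "real (sum w (support F)) * real k \<le> 4 * real (sum w active) * (harm n - harm (n - r))"
      using F by (simp add: forest_def)
    have "real ((n - r) * k * c) \<le> real (4 * sum w active)"
      using bound unfolding cardT of_nat_le_iff .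
    then show "real c * real k \<le> 4 * real (sum w active) / real (n - r)"
      using r by (simp add: field_simps)
  qed
  also have "\<dots> = 4 * real (sum w active) * (harm n - harm (n - Suc r))"
  proof -
    have "n - r = Suc (n - Suc r)" using r by simp
    then have "harm (n - r) = harm (n - Suc r) + inverse (real (n - r))"
      by (metis harm_Suc)
    then show ?thesis by (simp add: algebra_simps divide_inverse)
  qed
  finally show "real (sum w (support F')) * real k \<le> 4 * real (sum w active) * (harm n - harm (n - Suc r))" .
qed

lemma wp_mergeP:
  assumes s: "s 0 = g" "s aW = w" "s aDD 0 = 2 * d" "s aBIG 0 = B"
    and F: "forest w r (s aSZ) (s aH)" and r: "Suc r < n"
    and w: "support w = active" "sum w active < B"
  shows "wp N mergeP (\<lambda>s'. forest w (Suc r) (s' aSZ) (s' aH)) s"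
proof -
  have H: "2 * d \<le> N" using d bounds by simp
  have cardT: "2 \<le> card (terminals (s aSZ))" using F r by (simp add: forest_def)
  show ?thesis
    unfolding mergeP_def
  proof (rule wp_Seq, rule wp_conseq[OF wp_closestP[OF s(1,2) refl s(3) H s(4)]], goal_cases)
    case (1 s1)
    define sz u v c where "sz = s aSZ" and "u = s1 aBU 0" and "v = s1 aBV 0" and "c = s1 aBEST 0"
    have s1: "s1 0 = g" "s1 aSZ = sz" "s1 aH = s aH"
      using s 1(1) by (simp_all add: frameD sz_def)
    have C: "closest w sz (2 * d) B (all_pairs sz n) c u v (s1 aPS)"
      using 1(2) by (simp add: sz_def u_def v_def c_def)
    note cB = closest_bound[OF C w cardT[folded sz_def]]
    have uv: "u \<in> terminals sz" "v \<in> terminals sz" "u \<noteq> v" "linked w (2 * d) c u v (s1 aPS)"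
      using C cB(1) unfolding closest_def by auto
    then obtain p where p: "joins en v p u" "set p \<subseteq> support w" "length p \<le> 2 * d"
        "(\<Sum>e\<leftarrow>p. w e) = c" "support (s1 aPS) = set p"
      unfolding linked_def by blast
    note merge = forest_merge[OF F[folded sz_def] r w(1) cB(2)]
    \<comment> \<open>Either cluster may be the larger one. The traced walk leads from
      \<open>v\<close> to \<open>u\<close>, so it is reversed when \<open>u\<close> is
      absorbed.\<close>
    have *: "forest w (Suc r) (sz(v := sz u + sz v, u := 0)) F'"
      if "sz u \<le> sz v" "support F' = support (s aH) \<union> support (s1 aPS)" for F'
      by (rule merge[OF uv(1-3) that(1) joins_rev[OF p(1)]]) (use p that in \<open>auto simp: rev_map[symmetric]\<close>)
    have **: "forest w (Suc r) (sz(u := sz v + sz u, v := 0)) F'"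
      if "sz v \<le> sz u" "support F' = support (s aH) \<union> support (s1 aPS)" for F'
      by (rule merge[OF uv(2,1) uv(3)[symmetric] that(1) p(1)]) (use p that in auto)
    \<comment> \<open>Sizes are updated before \<open>aH\<close>, so the condition after
      \<open>joinP\<close> must hold for every array with the support that \<open>addpathP\<close>
      will produce.\<close>
    let ?Q = "\<lambda>sz'. \<forall>F'. support F' = support (s aH) \<union> support (s1 aPS) \<longrightarrow> forest w (Suc r) sz' F'"
    show ?case
    proof (rule wp_Seq, rule wp_conseq[OF wp_joinP[where Q = ?Q and s = s1 and sz = sz and u = u and v = v]], goal_cases)
      case (7 s2)
      have s2: "s2 0 = g" "s2 aH = s aH" "s2 aPS = s1 aPS"
        using s1 7(1) by (simp_all add: frameD)
      show ?case
        by (rule wp_conseq[OF wp_addpathP[where s = s2, OF s2(1)]])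
          (use 7(2) s2 in \<open>auto simp: frameD\<close>)
    qed (use uv s1 * ** in \<open>auto simp: u_def v_def\<close>)
  qed
qed

end

section \<open>Breadth-first search\<close>

text \<open>Since the root has level 1, round \<open>h\<close> expands level \<open>h + 1\<close>
  and assigns level \<open>h + 2\<close>.\<close>

definition growP :: "expr \<Rightarrow> expr \<Rightarrow> prog" where
  "growP a b = When (andE (eqE (Cell aLEV a) (Add (var cH) (Const 1))) (eqE (Cell aLEV b) (Const 0)))
     (Seq (Assign aLEV b (Add (var cH) (Const 2))) (Assign aT (var cE) (Const 1)))"

definition growallP :: prog where
  "growallP = For cE mE (When (Cell aH (var cE))
     (Seq (growP (srcE (var cE)) (dstE (var cE))) (growP (dstE (var cE)) (srcE (var cE)))))"

definition rootP :: prog where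
  "rootP = For cV nE (When (Cell aSZ (var cV)) (setv aR (var cV)))"

definition bfsP :: prog where
  "bfsP =
     Seq (For cV nE (Assign aLEV (var cV) (Const 0)))
    (Seq (For cE mE (Assign aT (var cE) (Const 0)))
    (Seq rootP
    (Seq (Assign aLEV (var aR) (Const 1))
         (For cH nE growallP))))"

lemma mods_growP [simp]: "mods (growP a b) = {aLEV, aT}"
  by (auto simp: growP_def)
lemma mods_growallP [simp]: "mods growallP = {cE, aLEV, aT}"
  by (auto simp: growallP_def)
lemma mods_rootP [simp]: "mods rootP = {cV, aR}"
  by (auto simp: rootP_def)
lemma mods_bfsP [simp]: "mods bfsP = {cV, cE, cH, aR, aLEV, aT}"
  by (auto simp: bfsP_def)

context connected_input
begin

definition unique_parents :: "nat set \<Rightarrow> (nat \<Rightarrow> nat) \<Rightarrow> bool" where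
  "unique_parents T lev \<longleftrightarrow> (\<forall>e\<in>T. \<forall>f\<in>T. \<forall>a a' b. en e = {a, b} \<longrightarrow> en f = {a', b} \<longrightarrow>
     lev b = Suc (lev a) \<longrightarrow> lev b = Suc (lev a') \<longrightarrow> e = f)"

lemma unique_parentsD:
  "unique_parents T lev \<Longrightarrow> e \<in> T \<Longrightarrow> f \<in> T \<Longrightarrow> en e = {a, b} \<Longrightarrow> en f = {a', b} \<Longrightarrow>
   lev b = Suc (lev a) \<Longrightarrow> lev b = Suc (lev a') \<Longrightarrow> e = f"
  unfolding unique_parents_def by blast

text \<open>Levels up to \<open>h\<close> are closed: their neighbours are reached, at most one
  level higher. \<open>X\<close> contains the darts scanned in the current round, for which this is
  known only in the form that ends next to level \<open>h + 1\<close> are reached.\<close>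

definition bfs_inv :: "(nat \<Rightarrow> nat) \<Rightarrow> nat \<Rightarrow> nat \<Rightarrow> (nat \<times> nat \<times> nat) set \<Rightarrow> (nat \<Rightarrow> nat) \<Rightarrow> (nat \<Rightarrow> nat) \<Rightarrow> bool" where
  "bfs_inv F r h X lev T \<longleftrightarrow> lev r = 1 \<and> support T \<subseteq> support F \<and>
     (\<forall>v<n. lev v \<le> Suc (Suc h)) \<and>
     (\<forall>v<n. lev v \<noteq> 0 \<longrightarrow> v \<noteq> r \<longrightarrow> (\<exists>e\<in>support T. \<exists>a. en e = {a, v} \<and> lev v = Suc (lev a))) \<and>
     (\<forall>e\<in>support T. \<exists>a b. en e = {a, b} \<and> lev b = Suc (lev a) \<and> lev a \<noteq> 0) \<and>
     unique_parents (support T) lev \<and>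
     (\<forall>(e, a, b)\<in>darts F m. lev a \<noteq> 0 \<longrightarrow> lev a \<le> h \<longrightarrow> lev b \<noteq> 0 \<and> lev b \<le> Suc (lev a)) \<and>
     (\<forall>(e, a, b)\<in>X. lev a = Suc h \<longrightarrow> lev b \<noteq> 0)"

lemma bfs_invD:
  assumes "bfs_inv F r h X lev T"
  shows "lev r = 1" "support T \<subseteq> support F" "\<forall>v<n. lev v \<le> Suc (Suc h)"
    "\<forall>v<n. lev v \<noteq> 0 \<longrightarrow> v \<noteq> r \<longrightarrow> (\<exists>e\<in>support T. \<exists>a. en e = {a, v} \<and> lev v = Suc (lev a))"
    "\<forall>e\<in>support T. \<exists>a b. en e = {a, b} \<and> lev b = Suc (lev a) \<and> lev a \<noteq> 0"
    "unique_parents (support T) lev"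
    "\<forall>(e, a, b)\<in>darts F m. lev a \<noteq> 0 \<longrightarrow> lev a \<le> h \<longrightarrow> lev b \<noteq> 0 \<and> lev b \<le> Suc (lev a)"
    "\<forall>(e, a, b)\<in>X. lev a = Suc h \<longrightarrow> lev b \<noteq> 0"
  by (insert assms, unfold bfs_inv_def) (elim conjE, assumption)+

lemma bfs_inv_keep:
  "bfs_inv F r h X lev T \<Longrightarrow> \<not> (lev a = Suc h \<and> lev b = 0) \<Longrightarrow> bfs_inv F r h (insert (e, a, b) X) lev T"
  unfolding bfs_inv_def by auto

text \<open>All ends of tree edges have nonzero level, so the unreached \<open>b\<close> lies on
  none of them. Relabelling \<open>b\<close> therefore disturbs no old parent, and \<open>e\<close>
  is the only tree edge at \<open>b\<close>.\<close>

lemma bfs_inv_grow: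
  assumes I: "bfs_inv F r h X lev T" and e: "(e, a, b) \<in> darts F m" and lev: "lev a = Suc h" "lev b = 0"
  shows "bfs_inv F r h (insert (e, a, b) X) (lev(b := Suc (Suc h))) (T(e := 1))"
proof -
  have e': "e \<in> support F" "en e = {a, b}" using e by (auto simp: in_darts_iff)
  have T: "support (T(e := 1)) = insert e (support T)" using e' by (auto simp: support_def)
  have new: "b \<notin> en f" if f: "f \<in> support T" for f
  proof -
    obtain x y where "en f = {x, y}" "lev y = Suc (lev x)" "lev x \<noteq> 0"
      using bfs_invD(5)[OF I] f by blast
    then show ?thesis using lev(2) by auto
  qed
  have ab: "a \<noteq> b" using lev by auto
  have r: "lev r = 1" "r \<noteq> b" using bfs_invD(1)[OF I] lev(2) by auto
  let ?lev = "lev(b := Suc (Suc h))"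
  have parent: "\<exists>f\<in>insert e (support T). \<exists>x. en f = {x, v} \<and> ?lev v = Suc (?lev x)"
    if v: "v < n" "?lev v \<noteq> 0" "v \<noteq> r" for v
  proof (cases "v = b")
    case True
    then show ?thesis using e' lev ab by auto
  next
    case False
    then obtain f x where f: "f \<in> support T" "en f = {x, v}" "lev v = Suc (lev x)"
      using bfs_invD(4)[OF I] v by (metis fun_upd_other)
    moreover have "x \<noteq> b" using new[OF f(1)] f(2) by auto
    ultimately show ?thesis using False by auto
  qed
  have layer: "\<exists>x y. en f = {x, y} \<and> ?lev y = Suc (?lev x) \<and> ?lev x \<noteq> 0" if "f \<in> insert e (support T)" for f
  proof (cases "f = e")
    case True
    then have "en f = {a, b} \<and> ?lev b = Suc (?lev a) \<and> ?lev a \<noteq> 0" using e' lev ab by simp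
    then show ?thesis by blast
  next
    case False
    then have f: "f \<in> support T" using that by auto
    then obtain x y where xy: "en f = {x, y}" "lev y = Suc (lev x)" "lev x \<noteq> 0"
      using bfs_invD(5)[OF I] by metis
    then have "x \<noteq> b" "y \<noteq> b" using new[OF f] by auto
    with xy have "en f = {x, y} \<and> ?lev y = Suc (?lev x) \<and> ?lev x \<noteq> 0" by simp
    then show ?thesis by blast
  qed
  have top: "y = b" if "en e = {x, y}" "?lev y = Suc (?lev x)" for x y
    using that e' lev ab by (auto simp: doubleton_eq_iff)
  have uniq: "f = f'" if f: "f \<in> insert e (support T)" "f' \<in> insert e (support T)"
      "en f = {x, y}" "en f' = {x', y}" "?lev y = Suc (?lev x)" "?lev y = Suc (?lev x')" for f f' x x' y
  proof (cases "f = e \<or> f' = e")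
    case True
    then have "y = b" using top f by blast
    then show ?thesis using f new by blast
  next
    case False
    then have T: "f \<in> support T" "f' \<in> support T" using f by auto
    then have "y \<noteq> b" "x \<noteq> b" "x' \<noteq> b" using f new by blast+
    then have "lev y = Suc (lev x)" "lev y = Suc (lev x')" using f by auto
    then show ?thesis using T f(3,4) unique_parentsD[OF bfs_invD(6)[OF I]] by blast
  qed
  have unique: "unique_parents (insert e (support T)) ?lev"
    unfolding unique_parents_def using uniq by blast
  have closed: "?lev y \<noteq> 0 \<and> ?lev y \<le> Suc (?lev x)"
    if f: "(f, x, y) \<in> darts F m" "?lev x \<noteq> 0" "?lev x \<le> h" for f x y
  proof -
    have "x \<noteq> b" using f by auto
    then have "lev y \<noteq> 0 \<and> lev y \<le> Suc (lev x)" using bfs_invD(7)[OF I] f by auto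
    then show ?thesis using lev(2) \<open>x \<noteq> b\<close> by auto
  qed
  have seen: "?lev y \<noteq> 0" if f: "(f, x, y) \<in> insert (e, a, b) X" "?lev x = Suc h" for f x y
  proof -
    have "lev x = Suc h" using f by (auto split: if_splits)
    then show ?thesis using bfs_invD(8)[OF I] f by auto
  qed
  show ?thesis
    unfolding bfs_inv_def T
  proof (intro conjI)
    show "?lev r = 1" using r by simp
    show "insert e (support T) \<subseteq> support F" using bfs_invD(2)[OF I] e'(1) by simp
    show "\<forall>v<n. ?lev v \<le> Suc (Suc h)" using bfs_invD(3)[OF I] by simp
    show "\<forall>v<n. ?lev v \<noteq> 0 \<longrightarrow> v \<noteq> r \<longrightarrow>
        (\<exists>e\<in>insert e (support T). \<exists>a. en e = {a, v} \<and> ?lev v = Suc (?lev a))"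
      using parent by blast
    show "\<forall>e\<in>insert e (support T). \<exists>a b. en e = {a, b} \<and> ?lev b = Suc (?lev a) \<and> ?lev a \<noteq> 0"
      using layer by blast
    show "unique_parents (insert e (support T)) ?lev" by (rule unique)
    show "\<forall>(f, x, y)\<in>darts F m. ?lev x \<noteq> 0 \<longrightarrow> ?lev x \<le> h \<longrightarrow> ?lev y \<noteq> 0 \<and> ?lev y \<le> Suc (?lev x)"
      using closed by blast
    show "\<forall>(f, x, y)\<in>insert (e, a, b) X. ?lev x = Suc h \<longrightarrow> ?lev y \<noteq> 0"
      using seen by blast
  qed
qed

lemma wp_growP:
  assumes "s 0 = g" "s cH 0 = h" "s cE 0 = e"
    and "eval_expr a s = x" "\<And>s'. s' 0 = s 0 \<Longrightarrow> s' cE = s cE \<Longrightarrow> eval_expr a s' = x"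
    and "eval_expr b s = y" "\<And>s'. s' 0 = s 0 \<Longrightarrow> s' cE = s cE \<Longrightarrow> eval_expr b s' = y"
    and "(e, x, y) \<in> darts F m" "bfs_inv F r h X (s aLEV) (s aT)"
  shows "wp N (growP a b) (\<lambda>s'. bfs_inv F r h (insert (e, x, y) X) (s' aLEV) (s' aT)) s"
  unfolding growP_def
  apply (intro wp_When wp_Seq wp_Assign)
  using assms(1-7) bfs_inv_grow[OF assms(9,8)] apply (simp add: fun_upd_def)
  using assms(1-7) bfs_inv_keep[OF assms(9), of x y e] apply (simp split: if_splits)
  done

lemma wp_growallP:
  assumes s: "s 0 = g" "s aH = F" "s cH 0 = h" and I: "bfs_inv F r h {} (s aLEV) (s aT)"
  shows "wp N growallP (\<lambda>s'. bfs_inv F r h (darts F m) (s' aLEV) (s' aT)) s"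
  unfolding growallP_def
proof (rule wp_For[where hi = m and I = "\<lambda>j s'. bfs_inv F r h (darts F j) (s' aLEV) (s' aT)"], goal_cases)
  case (2 s')
  then show ?case using s by (simp add: frameD)
next
  case (5 j s')
  have s': "s' 0 = g" "s' cH 0 = h" "s' cE 0 = j" "s' aH = F" using 5 s by (simp_all add: frameD)
  note j = \<open>j < m\<close>
  show ?case
  proof (intro wp_When wp_Seq, goal_cases)
    case 1
    then have Fj: "F j \<noteq> 0" using s' by simp
    then have darts: "(j, src_of g j, dst_of g j) \<in> darts F m" "(j, dst_of g j, src_of g j) \<in> darts F m"
      using j by (auto simp: darts_def)
    show ?case
    proof (rule wp_conseq[OF wp_growP[where s = s', OF s'(1-3) _ _ _ _ darts(1) 5(4)]], goal_cases)
      case (5 s1)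
      have s1: "s1 0 = g" "s1 cH 0 = h" "s1 cE 0 = j" using s' 5(1) by (simp_all add: frameD)
      show ?case
        by (rule wp_conseq[OF wp_growP[where s = s1, OF s1 _ _ _ _ darts(2) 5(2)]])
          (use s1 j Fj in \<open>simp_all add: darts_Suc\<close>)
    qed (use s' in simp_all)
  next
    case 2
    then show ?case using s' 5(4) by (simp add: darts_Suc_zero)
  qed
qed (use bounds I in simp_all)

lemma wp_rootP:
  assumes s: "s 0 = g" "s aSZ = sz" "terminals sz \<noteq> {}"
  shows "wp N rootP (\<lambda>s'. s' aR 0 \<in> terminals sz) s"
  unfolding rootP_def
proof (rule wp_For[where hi = n and I = "\<lambda>j s'. (\<exists>v<j. v \<in> terminals sz) \<longrightarrow> s' aR 0 \<in> terminals sz"], goal_cases)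
  case (2 s')
  then show ?case using s by (simp add: frameD)
next
  case (5 j s')
  then have "s' aSZ = sz" using s by (simp add: frameD)
  then show ?case using 5 by (intro wp_When wp_Assign) (auto simp: terminals_def less_Suc_eq)
next
  case (6 s')
  then show ?case using s(3) by (auto simp: terminals_def)
qed (use n_le in simp_all)

text \<open>After a full scan all neighbours of level \<open>h + 1\<close> are reached, and their
  level is at most \<open>h + 2\<close> because no higher level has been assigned.\<close>

lemma bfs_inv_round:
  assumes "bfs_inv F r h (darts F m) lev T"
  shows "bfs_inv F r (Suc h) {} lev T" "\<forall>v<n. lev v \<le> Suc (Suc h)"
proof -
  show le: "\<forall>v<n. lev v \<le> Suc (Suc h)" using bfs_invD(3)[OF assms] .
  have "lev b \<noteq> 0 \<and> lev b \<le> Suc (lev a)"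
    if f: "(e, a, b) \<in> darts F m" "lev a \<noteq> 0" "lev a \<le> Suc h" for e a b
  proof (cases "lev a = Suc h")
    case True
    then show ?thesis using bfs_invD(8)[OF assms] f le darts_bound[OF f(1)] by auto
  next
    case False
    then show ?thesis using bfs_invD(7)[OF assms] f by auto
  qed
  moreover have "\<forall>v<n. lev v \<le> Suc (Suc (Suc h))" using le le_SucI by blast
  ultimately show "bfs_inv F r (Suc h) {} lev T"
    unfolding bfs_inv_def using bfs_invD(1,2,4-6)[OF assms] by blast
qed

lemma wp_bfsP:
  assumes s: "s 0 = g" "s aSZ = sz" "s aH = F" "terminals sz \<noteq> {}"
  shows "wp N bfsP (\<lambda>s'. \<exists>r\<in>terminals sz. bfs_inv F r n {} (s' aLEV) (s' aT)) s"
  unfolding bfsP_def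
proof (rule wp_Seq, rule wp_For[where hi = n and I = "\<lambda>j s'. \<forall>v<j. s' aLEV v = 0"], goal_cases)
  case (2 s')
  then show ?case using s by (simp add: frameD)
next
  case (5 j s')
  then show ?case by (intro wp_Assign) (simp add: less_Suc_eq)
next
  case (6 s1)
  have s1: "s1 0 = g" "s1 aSZ = sz" "s1 aH = F"
    using s 6(1) by (simp_all add: frameD)
  have lev1: "\<And>v. v < n \<Longrightarrow> s1 aLEV v = 0" using 6(2) by blast
  show ?case
  proof (rule wp_Seq, rule wp_For[where hi = m and I = "\<lambda>j s'. \<forall>v<j. s' aT v = 0"], goal_cases)
    case (2 s')
    then show ?case using s1 by (simp add: frameD)
  next
    case (5 j s')
    then show ?case by (intro wp_Assign) (simp add: less_Suc_eq)
  next
    case (6 s2)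
    have s2: "s2 0 = g" "s2 aSZ = sz" "s2 aH = F" "s2 aLEV = s1 aLEV"
      using s1 6(1) by (simp_all add: frameD)
    have T2: "support (s2 aT) = {}" using 6(2) by (auto simp: support_def)
    show ?case
    proof (rule wp_Seq, rule wp_conseq[OF wp_rootP[OF s2(1,2) s(4)]], goal_cases)
      case (1 s3)
      have s3: "s3 0 = g" "s3 aSZ = sz" "s3 aH = F" "s3 aLEV = s1 aLEV" "s3 aT = s2 aT"
        using s2 1(1) by (simp_all add: frameD)
      define r where "r = s3 aR 0"
      have r: "r < n" "r \<in> terminals sz" using 1(2) by (auto simp: r_def terminals_def)
      have init: "bfs_inv F r 0 {} ((s1 aLEV)(r := 1)) (s2 aT)"
        unfolding bfs_inv_def unique_parents_def T2 using lev1 r by auto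
      show ?case
      proof (intro wp_Seq wp_Assign, rule wp_For[where hi = n and
            I = "\<lambda>h s'. bfs_inv F r h {} (s' aLEV) (s' aT)"], goal_cases)
        case (2 s')
        then show ?case using s3 by (simp add: frameD)
      next
        case 4
        then show ?case using s3 init by (simp add: r_def fun_upd_def)
      next
        case (5 h s4)
        have s4: "s4 0 = g" "s4 aH = F" "s4 cH 0 = h"
          using s3 5(2,3) by (simp_all add: frameD)
        show ?case
          by (rule wp_conseq[OF wp_growallP[where s = s4, OF s4 5(4)]]) (simp add: bfs_inv_round(1))
      next
        case (6 s')
        then show ?case using r by blast
      qed (use n_le in simp_all)
    qed
  qed (use bounds in simp_all)
qed (use n_le in simp_all)

text \<open>After \<open>i\<close> edges the level is at most \<open>i + 1\<close>, so a walk of at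
  most \<open>n\<close> edges only expands levels up to \<open>n\<close>, which are closed after
  \<open>n\<close> rounds.\<close>

lemma bfs_inv_reach:
  assumes I: "bfs_inv F r n {} lev T"
    and "joins en r es v" "set es \<subseteq> support F" "length es \<le> n"
  shows "lev v \<noteq> 0 \<and> lev v \<le> Suc (length es)"
  using assms(2-)
proof (induction es arbitrary: v rule: rev_induct)
  case Nil
  then show ?case using I by (auto simp: bfs_inv_def)
next
  case (snoc e es)
  then obtain x where x: "joins en r es x" "en e = {x, v}" by (auto simp: joins_append)
  then have "lev x \<noteq> 0 \<and> lev x \<le> Suc (length es)" using snoc by auto
  moreover have "(e, x, v) \<in> darts F m" using x snoc.prems by (simp add: in_darts_iff)
  ultimately show ?case using bfs_invD(7)[OF I] snoc.prems by fastforce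
qed

abbreviation "graph \<equiv> \<lparr>verts = {..<n}, edges = {..<m}, ends = en\<rparr>"

text \<open>Only one center is left, so every vertex is linked to \<open>r\<close> by at most
  \<open>j * (2 * d)\<close> edges with \<open>2 ^ j \<le> n\<close>. The constant 4 is this 2 times
  another 2 for passing through the root.\<close>

lemma bfs_tree:
  assumes F: "forest w (n - 1) sz F" and r: "r \<in> terminals sz" and I: "bfs_inv F r n {} lev T"
  shows "is_spanning_tree graph (support T)"
    "real (graph_diameter (spanning_subgraph graph (support T))) \<le> 4 * real d * log 2 (real n)"
proof -
  define J where "J = nat \<lfloor>log 2 (real n)\<rfloor>"
  have "card (terminals sz) = 1" using F pos by (simp add: forest_def)
  then obtain x where "terminals sz = {x}" by (rule card_1_singletonE)
  then have terminals: "terminals sz = {r}" using r by simp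
  have depth: "lev v \<noteq> 0 \<and> lev v \<le> lev r + J * (2 * d)" if v: "v < n" for v
  proof -
    obtain c j es where c: "c < n" "joins en v es c" "set es \<subseteq> support F" "length es \<le> j * (2 * d)" "2 ^ j \<le> sz c"
      using F v unfolding forest_def clustered_def by (metis lessThan_iff)
    have "sz c \<noteq> 0" using c(5) by (metis le_zero_eq power_not_zero zero_neq_numeral)
    then have "c = r" using terminals c(1) by (auto simp: terminals_def)
    have "sz c \<le> sum sz {..<n}" using c(1) by (intro member_le_sum) auto
    then have "2 ^ j \<le> n" using c(5) F by (simp add: forest_def)
    then have "real j \<le> log 2 (real n)" by (rule le_log2_of_power)
    then have j: "j \<le> J" by (simp add: J_def le_nat_floor)
    let ?H = "\<lparr>verts = {..<n}, edges = support F, ends = en\<rparr>"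
    \<comment> \<open>Shortcutting keeps the hop bound and leaves fewer than \<open>n\<close> edges,
      as \<open>bfs_inv_reach\<close> requires.\<close>
    have "\<exists>vs p. is_path ?H r vs p v \<and> length p \<le> length (rev es)"
      using c v joins_rev[OF c(2)] en src dst \<open>c = r\<close>
      by (intro joins_is_path) (auto simp: support_def)
    then obtain vs p where p: "is_path ?H r vs p v" "length p \<le> length es" by auto
    then have "joins en r p v" "set p \<subseteq> support F" "length p < n"
      using is_path_joins[OF p(1)] is_path_length_less[OF p(1)] by auto
    then have "lev v \<noteq> 0 \<and> lev v \<le> Suc (length p)" using bfs_inv_reach[OF I] by simp
    moreover have "length p \<le> J * (2 * d)"
      using p(2) c(4) j mult_le_mono1[OF j, of "2 * d"] by linarith
    ultimately show ?thesis using bfs_invD(1)[OF I] by auto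
  qed
  have ends: "ends graph e \<subseteq> verts graph" if "e \<in> edges graph" for e
    using en[of e] src[of e] dst[of e] that by simp
  have layer: "\<exists>a b. ends graph e = {a, b} \<and> lev b = Suc (lev a)" if "e \<in> support T" for e
    using bfs_invD(5)[OF I] that by simp blast
  have uniq: "e = f" if "e \<in> support T" "f \<in> support T" "ends graph e = {a, b}" "ends graph f = {a', b}"
      "lev b = Suc (lev a)" "lev b = Suc (lev a')" for e f a a' b
    by (rule unique_parentsD[OF bfs_invD(6)[OF I], of e f a b a']) (use that in simp_all)
  have parent: "\<exists>e\<in>support T. \<exists>a. ends graph e = {a, v} \<and> lev v = Suc (lev a)"
    if "v \<in> verts graph" "v \<noteq> r" for v
    using bfs_invD(4)[OF I] depth[of v] that by simp
  have basic: "finite (verts graph)" "r \<in> verts graph" "support T \<subseteq> edges graph"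
    using r by (auto simp: terminals_def support_def)
  have depth': "lev v \<le> lev r + J * (2 * d)" if "v \<in> verts graph" for v
    using depth[of v] that by simp
  show "is_spanning_tree graph (support T)"
    by (rule layered_spanning_tree(1)[where lev = lev and r = r and R = "J * (2 * d)"];
        fact basic ends layer uniq parent depth')
  have "graph_diameter (spanning_subgraph graph (support T)) \<le> 2 * (J * (2 * d))"
    by (rule layered_spanning_tree(2)[where lev = lev and r = r and R = "J * (2 * d)"];
        fact basic ends layer uniq parent depth')
  moreover have "real (2 * (J * (2 * d))) \<le> 4 * real d * log 2 (real n)"
  proof -
    have "real J \<le> log 2 (real n)" using pos by (simp add: J_def)
    then have "real d * real J \<le> real d * log 2 (real n)" by (intro mult_left_mono) auto
    then show ?thesis by (simp add: mult_ac)
  qed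
  ultimately show "real (graph_diameter (spanning_subgraph graph (support T))) \<le> 4 * real d * log 2 (real n)"
    by linarith
qed

end

section \<open>Multiplicative weights\<close>

definition growtreeP :: prog where
  "growtreeP =
     Seq (For cV nE (Assign aSZ (var cV) (Const 1)))
    (Seq (For cE mE (Assign aH (var cE) (Const 0)))
    (Seq (For cM (Sub nE (Const 1)) mergeP)
         bfsP))"

definition emitP :: prog where
  "emitP = For cE mE
     (Seq (Assign 1 (Add (var aROW) (var cE)) (Cell aT (var cE)))
          (When (Cell aH (var cE))
            (Assign aW (var cE) (Add (Cell aW (var cE)) (Cell aW (var cE))))))"

definition parallelE :: "expr \<Rightarrow> expr \<Rightarrow> expr" where
  "parallelE e f = Add (andE (eqE (srcE e) (srcE f)) (eqE (dstE e) (dstE f)))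
     (andE (eqE (srcE e) (dstE f)) (eqE (dstE e) (srcE f)))"

definition countP :: prog where
  "countP = For cF (var cE) (When (parallelE (var cF) (var cE)) (setv aCNT (Add (var aCNT) (Const 1))))"

definition weightsP :: prog where
  "weightsP = For cE mE
     (Seq (setv aCNT (Const 0)) (Seq countP (Assign aW (var cE) (Less (var aCNT) kE))))"

definition initP :: prog where
  "initP =
     Seq (setv aDD nE)
    (Seq (When (Less (Cell 0 (Const 0)) nE) (setv aDD (Cell 0 (Const 0))))
    (Seq (setv aDD (Add (var aDD) (var aDD)))
    (Seq weightsP
    (Seq (setv aBIG (Add mE (Const 1)))
         (setv aROW (Const 0))))))"

text \<open>No weight more than doubles in a round, so doubling \<open>aBIG\<close> keeps it above
  the total weight.\<close>

definition mainP :: prog where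
  "mainP = Seq initP (For cL kE
     (Seq growtreeP
     (Seq emitP
     (Seq (setv aBIG (Add (var aBIG) (var aBIG)))
          (setv aROW (Add (var aROW) mE))))))"

lemma mods_growtreeP [simp]:
  "mods growtreeP = {cM, cU, cV, cE, cH, aF, aPE, aPV, aOFF, aPS, aX, aO, aBEST, aBU, aBV, aSZ, aH, aR, aLEV, aT}"
  by (auto simp: growtreeP_def)
lemma mods_emitP [simp]: "mods emitP = {cE, 1, aW}"
  by (auto simp: emitP_def)
lemma mods_countP [simp]: "mods countP = {cF, aCNT}"
  by (auto simp: countP_def)
lemma mods_weightsP [simp]: "mods weightsP = {cE, cF, aCNT, aW}"
  by (auto simp: weightsP_def)
lemma mods_initP [simp]: "mods initP = {cE, cF, aCNT, aW, aDD, aBIG, aROW}"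
  by (auto simp: initP_def)

context ram_input
begin

lemma wp_countP:
  assumes s: "s 0 = g" "s cE 0 = e" "e < m" "s aCNT 0 = 0"
  shows "wp N countP (\<lambda>s'. s' aCNT 0 = card {f. f < e \<and> en f = en e}) s"
  unfolding countP_def
proof (rule wp_For[where hi = e and I = "\<lambda>j s'. s' aCNT 0 = card {f. f < j \<and> en f = en e}"], goal_cases)
  case (2 s')
  then show ?case using s by (simp add: frameD)
next
  case (5 j s')
  have s': "s' 0 = g" "s' cF 0 = j" "s' cE 0 = e" using 5 s by (simp_all add: frameD)
  have test: "eval_expr (parallelE (var cF) (var cE)) s' \<noteq> 0 \<longleftrightarrow> en j = en e"
    using s' 5(1) s(3) en[of j] en[of e] by (auto simp: parallelE_def doubleton_eq_iff)
  show ?case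
  proof (intro wp_When wp_Assign, goal_cases)
    case 1
    then have "{f. f < Suc j \<and> en f = en e} = insert j {f. f < j \<and> en f = en e}"
      using test by (auto simp: less_Suc_eq)
    then show ?case using 5(4) by simp
  next
    case 2
    then have "{f. f < Suc j \<and> en f = en e} = {f. f < j \<and> en f = en e}"
      using test by (auto simp: less_Suc_eq)
    then show ?case using 5(4) by simp
  qed
qed (use s bounds in simp_all)

lemma wp_weightsP:
  assumes s: "s 0 = g"
  shows "wp N weightsP (\<lambda>s'. \<forall>e<m. s' aW e = of_bool (e \<in> active_edges en m k)) s"
  unfolding weightsP_def
proof (rule wp_For[where hi = m and I = "\<lambda>j s'. \<forall>e<j. s' aW e = of_bool (e \<in> active_edges en m k)"], goal_cases)
  case (2 s')
  then show ?case using s by (simp add: frameD)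
next
  case (5 j s')
  let ?s = "store s' aCNT 0 0"
  have s': "?s 0 = g" "?s cE 0 = j" "?s aCNT 0 = 0" using 5 s by (simp_all add: frameD)
  show ?case
  proof (intro wp_Seq wp_Assign, simp only: eval_expr.simps,
      rule wp_conseq[OF wp_countP[where s = ?s, OF s'(1,2) 5(1) s'(3)]], goal_cases)
    case (1 s'')
    have "s'' 0 = g" "s'' cE 0 = j" "s'' aW = s' aW" using s' 1(1) by (simp_all add: frameD)
    then show ?case using 5(1,4) 1(2)
      by (intro wp_Assign) (simp add: less_Suc_eq active_edges_def)
  qed
qed (use bounds in simp_all)

lemma wp_emitP:
  assumes s: "s 0 = g" "s aROW 0 = base" "s aT = T" "s aH = F" "s aW = w"
  shows "wp N emitP (\<lambda>s'. (\<forall>i<base. s' 1 i = s 1 i) \<and> (\<forall>e<m. s' 1 (base + e) = T e) \<and>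
    (\<forall>e<m. s' aW e = (if F e = 0 then w e else 2 * w e))) s"
  unfolding emitP_def
proof (rule wp_For[where hi = m and I = "\<lambda>j s'. (\<forall>i<base. s' 1 i = s 1 i) \<and> (\<forall>e<j. s' 1 (base + e) = T e) \<and>
    (\<forall>e. s' aW e = (if F e = 0 \<or> j \<le> e then w e else 2 * w e))"], goal_cases)
  case (2 s')
  then show ?case using s by (simp add: frameD)
next
  case (5 j s')
  have s': "s' 0 = g" "s' aROW 0 = base" "s' aT = T" "s' aH = F" "s' cE 0 = j"
    using 5 s by (simp_all add: frameD)
  show ?case using s' 5(4) by (intro wp_Seq wp_When wp_Assign) (auto simp: less_Suc_eq not_less_eq_eq)
qed (use bounds s in simp_all)

end

section \<open>The potential argument\<close>

context connected_input
begin

definition good_tree :: "nat set \<Rightarrow> bool" where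
  "good_tree T \<longleftrightarrow> is_spanning_tree graph T \<and>
     real (graph_diameter (spanning_subgraph graph T)) \<le> 4 * real d * log 2 (real n)"

lemma forest_init:
  assumes "\<forall>v<n. sz v = 1" "\<forall>e<m. F e = 0"
  shows "forest w 0 sz F"
proof -
  have "terminals sz = {..<n}" using assms by (auto simp: terminals_def)
  moreover have "support F = {}" using assms by (auto simp: support_def)
  moreover have "sum sz {..<n} = n" using assms by simp
  moreover have "clustered en {} {..<n} (2 * d) sz"
    unfolding clustered_def
  proof
    fix v assume "v \<in> {..<n}"
    then show "\<exists>c\<in>{..<n}. \<exists>j es. joins en v es c \<and> set es \<subseteq> {} \<and> length es \<le> j * (2 * d) \<and> 2 ^ j \<le> sz c"
      using assms by (intro bexI[of _ v] exI[of _ 0] exI[of _ "[]"]) auto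
  qed
  ultimately show ?thesis by (simp add: forest_def)
qed

text \<open>Stopping at one center subtracts \<open>harm 1 = 1\<close>, which cancels the 1 in
  \<open>harm_le_ln\<close>.\<close>

lemma forest_weight:
  assumes "forest w (n - 1) sz F"
  shows "real (sum w (support F)) * real k \<le> 4 * real (sum w active) * ln (real n)"
proof -
  have "harm n - harm (n - (n - 1)) \<le> ln (real n)"
    using harm_le_ln[of n] pos by (simp add: harm_expand)
  then have "4 * real (sum w active) * (harm n - harm (n - (n - 1))) \<le> 4 * real (sum w active) * ln (real n)"
    by (intro mult_left_mono mult_nonneg_nonneg of_nat_0_le_iff) simp_all
  then show ?thesis using assms unfolding forest_def by linarith
qed

lemma wp_growtreeP:
  assumes s: "s 0 = g" "s aW = w" "s aDD 0 = 2 * d" "s aBIG 0 = B"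
    and w: "support w = active" "sum w active < B"
  shows "wp N growtreeP (\<lambda>s'. good_tree (support (s' aT)) \<and> support (s' aT) \<subseteq> support (s' aH) \<and>
    support (s' aH) \<subseteq> active \<and>
    real (sum w (support (s' aH))) * real k \<le> 4 * real (sum w active) * ln (real n)) s"
  unfolding growtreeP_def
proof (rule wp_Seq, rule wp_For[where hi = n and I = "\<lambda>j s'. \<forall>v<j. s' aSZ v = 1"], goal_cases)
  case (2 s')
  then show ?case using s by (simp add: frameD)
next
  case (5 j s')
  then show ?case by (intro wp_Assign) (simp add: less_Suc_eq)
next
  case (6 s1)
  have s1: "s1 0 = g" "s1 aW = w" "s1 aDD 0 = 2 * d" "s1 aBIG 0 = B"
    using s 6(1) by (simp_all add: frameD)
  note sz = 6(2)
  show ?case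
  proof (rule wp_Seq, rule wp_For[where hi = m and I = "\<lambda>j s'. \<forall>v<j. s' aH v = 0"], goal_cases)
    case (2 s')
    then show ?case using s1 by (simp add: frameD)
  next
    case (5 j s')
    then show ?case by (intro wp_Assign) (simp add: less_Suc_eq)
  next
    case (6 s2)
    have s2: "s2 0 = g" "s2 aW = w" "s2 aDD 0 = 2 * d" "s2 aBIG 0 = B" "s2 aSZ = s1 aSZ"
      using s1 6(1) by (simp_all add: frameD)
    have init: "forest w 0 (s2 aSZ) (s2 aH)"
      using sz 6(2) s2 by (intro forest_init) simp_all
    show ?case
    proof (rule wp_Seq, rule wp_For[where hi = "n - 1" and I = "\<lambda>r s'. forest w r (s' aSZ) (s' aH)"], goal_cases)
      case (2 s')
      then show ?case using s2 by (simp add: frameD)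
    next
      case 4
      then show ?case using init by simp
    next
      case (5 r s')
      have s': "s' 0 = g" "s' aW = w" "s' aDD 0 = 2 * d" "s' aBIG 0 = B"
        using s2 5(3) by (simp_all add: frameD)
      show ?case
        by (rule wp_conseq[OF wp_mergeP[where s = s', OF s' 5(4) _ w]]) (use 5(1) in simp_all)
    next
      case (6 s3)
      have s3: "s3 0 = g" using s2 6(1) by (simp add: frameD)
      have "card (terminals (s3 aSZ)) = 1" using 6(2) pos by (simp add: forest_def)
      then have "terminals (s3 aSZ) \<noteq> {}" by auto
      then show ?case
      proof (rule wp_conseq[OF wp_bfsP[where s = s3, OF s3 refl refl]], goal_cases)
        case (1 s4)
        then obtain r where r: "r \<in> terminals (s3 aSZ)" "bfs_inv (s3 aH) r n {} (s4 aLEV) (s4 aT)" by blast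
        have "s4 aH = s3 aH" using 1(1) by (simp add: frameD)
        moreover have "support (s3 aH) \<subseteq> active" using 6(2) w by (simp add: forest_def)
        ultimately show ?case
          using bfs_tree[OF 6(2) r] bfs_invD(2)[OF r(2)] forest_weight[OF 6(2)] by (simp add: good_tree_def)
      qed
    qed (use n_le in simp_all)
  qed (use bounds in simp_all)
qed (use n_le in simp_all)

definition tree_at :: "(nat \<Rightarrow> nat) \<Rightarrow> nat \<Rightarrow> nat set" where
  "tree_at out l = {e. e < m \<and> out (l * m + e) \<noteq> 0}"

text \<open>The weight of an edge is only bounded below by its load, since edges of the linked
  subgraph outside the tree are doubled too. The sum over \<open>active\<close> is the
  potential.\<close>

definition round_inv :: "nat \<Rightarrow> (nat \<Rightarrow> nat) \<Rightarrow> (nat \<Rightarrow> nat) \<Rightarrow> nat \<Rightarrow> bool" where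
  "round_inv l out w B \<longleftrightarrow> support w = active \<and> sum w active < B \<and>
     (\<forall>i<l. good_tree (tree_at out i) \<and> tree_at out i \<subseteq> active) \<and>
     (\<forall>e\<in>active. 2 ^ card {i. i < l \<and> e \<in> tree_at out i} \<le> w e) \<and>
     real (sum w active) \<le> real n ^ 3 * (1 + 4 * ln (real n) / real k) ^ l"

text \<open>Doubling on \<open>F\<close> adds exactly the weight of \<open>support F\<close>: at
  most a fraction \<open>4 * ln n / k\<close> of the potential, which gives the factor, and at most
  the whole of it, which gives \<open>B + B\<close>.\<close>

lemma round_inv_Suc:
  assumes R: "round_inv l out w B" and T: "good_tree (support T)" "support T \<subseteq> support F" "support F \<subseteq> active"
    and F: "real (sum w (support F)) * real k \<le> 4 * real (sum w active) * ln (real n)"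
    and out: "\<forall>i<l * m. out' i = out i" "\<forall>e<m. out' (l * m + e) = T e"
    and w': "\<forall>e<m. w' e = (if F e = 0 then w e else 2 * w e)"
  shows "round_inv (Suc l) out' w' (B + B)"
  unfolding round_inv_def
proof (intro conjI)
  have supp: "support w = active" and B: "sum w active < B"
    and trees: "\<forall>i<l. good_tree (tree_at out i) \<and> tree_at out i \<subseteq> active"
    and load: "\<forall>e\<in>active. 2 ^ card {i. i < l \<and> e \<in> tree_at out i} \<le> w e"
    and pot: "real (sum w active) \<le> real n ^ 3 * (1 + 4 * ln (real n) / real k) ^ l"
    using R by (simp_all add: round_inv_def)
  have "support w' = support w" using w' by (auto simp: support_def split: if_splits)
  then show "support w' = active" using supp by simp
  have active: "e < m" if "e \<in> active" for e using that by (simp add: active_edges_def)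
  have "sum w' active = (\<Sum>e\<in>active. w e + (if e \<in> support F then w e else 0))"
    using w' active by (intro sum.cong) (auto simp: support_def)
  also have "\<dots> = sum w active + sum w (support F)"
    using T(3) by (simp add: sum.distrib sum.inter_restrict[symmetric] Int_absorb1)
  finally have sum': "sum w' active = sum w active + sum w (support F)" .
  have "sum w (support F) \<le> sum w active" using T(3) by (intro sum_mono2) auto
  then show "sum w' active < B + B" using B sum' by simp
  have old: "tree_at out' i = tree_at out i" if "i < l" for i
  proof -
    have "i * m + e < l * m" if "e < m" for e
    proof -
      have "i * m + e < Suc i * m" using that by simp
      also have "\<dots> \<le> l * m" using \<open>i < l\<close> by (intro mult_le_mono1) simp
      finally show ?thesis .
    qed
    then show ?thesis using out(1) by (auto simp: tree_at_def)
  qed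
  have new: "tree_at out' l = support T" using out(2) by (auto simp: tree_at_def support_def)
  show "\<forall>i<Suc l. good_tree (tree_at out' i) \<and> tree_at out' i \<subseteq> active"
    using trees old new T by (auto simp: less_Suc_eq)
  show "\<forall>e\<in>active. 2 ^ card {i. i < Suc l \<and> e \<in> tree_at out' i} \<le> w' e"
  proof
    fix e assume e: "e \<in> active"
    show "2 ^ card {i. i < Suc l \<and> e \<in> tree_at out' i} \<le> w' e"
    proof (cases "e \<in> support T")
      case True
      then have "{i. i < Suc l \<and> e \<in> tree_at out' i} = insert l {i. i < l \<and> e \<in> tree_at out i}"
        using old new by (auto simp: less_Suc_eq)
      moreover have "w' e = 2 * w e" using True T(2) w' by (auto simp: support_def)
      ultimately show ?thesis using load e by simp
    next
      case False
      then have "{i. i < Suc l \<and> e \<in> tree_at out' i} = {i. i < l \<and> e \<in> tree_at out i}"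
        using old new by (auto simp: less_Suc_eq)
      moreover have "w e \<le> w' e" using w' active[OF e] by simp
      ultimately show ?thesis using load e by (metis order_trans)
    qed
  qed
  have "real (sum w (support F)) \<le> real (sum w active) * (4 * ln (real n) / real k)"
    using F pos by (simp add: field_simps)
  then have "real (sum w' active) \<le> real (sum w active) * (1 + 4 * ln (real n) / real k)"
    unfolding sum' by (simp add: algebra_simps)
  also have "\<dots> \<le> real n ^ 3 * (1 + 4 * ln (real n) / real k) ^ l * (1 + 4 * ln (real n) / real k)"
    using pot pos by (intro mult_right_mono) auto
  finally show "real (sum w' active) \<le> real n ^ 3 * (1 + 4 * ln (real n) / real k) ^ Suc l"
    by (simp add: mult_ac)
qed

text \<open>At most \<open>k\<close> unit weights per ordered pair of vertices give
  \<open>k * n ^ 2\<close>, and \<open>k \<le> n\<close> turns this into the initial potential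
  \<open>n ^ 3\<close>.\<close>

lemma round_inv_0:
  assumes "k \<le> n" "\<forall>e<m. w e = of_bool (e \<in> active)"
  shows "round_inv 0 out w (m + 1)"
proof -
  have active: "e < m" if "e \<in> active" for e using that by (simp add: active_edges_def)
  have w: "w e = 1" if "e \<in> active" for e using assms(2) active[OF that] that by simp
  have sum: "sum w active = card active" using w by simp
  have "card active \<le> card {..<m}" using active by (intro card_mono) auto
  then have "card active < m + 1" by simp
  moreover have "card active \<le> k * n ^ 2"
    using en src dst by (intro card_active_edges_le) blast
  then have "card active \<le> n * n ^ 2" using assms(1) by (meson le_trans mult_le_mono1)
  then have "real (card active) \<le> real n ^ 3"
    by (metis of_nat_le_iff of_nat_power power_Suc power3_eq_cube power2_eq_square mult.assoc)
  moreover have "support w = active"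
    using assms(2) active by (auto simp: support_def)
  ultimately show ?thesis
    using w sum unfolding round_inv_def by simp
qed

lemma wp_initP:
  assumes s: "s 0 = g"
  shows "wp N initP (\<lambda>s'. s' aDD 0 = 2 * d \<and> (\<forall>e<m. s' aW e = of_bool (e \<in> active)) \<and>
    s' aBIG 0 = m + 1 \<and> s' aROW 0 = 0) s"
proof -
  have rest: "wp N (Seq (setv aDD (Add (var aDD) (var aDD))) (Seq weightsP
        (Seq (setv aBIG (Add mE (Const 1))) (setv aROW (Const 0)))))
      (\<lambda>s'. s' aDD 0 = 2 * d \<and> (\<forall>e<m. s' aW e = of_bool (e \<in> active)) \<and> s' aBIG 0 = m + 1 \<and> s' aROW 0 = 0) t"
    if t: "t 0 = g" "t aDD 0 = d" for t
  proof (rule wp_Seq, rule wp_Assign, rule wp_Seq, rule wp_conseq[OF wp_weightsP], goal_cases)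
    case 1
    then show ?case using t by simp
  next
    case (2 s')
    have "s' 0 = g" "s' aDD 0 = 2 * d" using t 2(1) by (simp_all add: frameD)
    then show ?case using 2(2) by (intro wp_Seq wp_Assign) simp
  qed
  show ?thesis
    unfolding initP_def
  proof (rule wp_Seq, rule wp_Assign, rule wp_Seq, rule wp_When, goal_cases)
    case 1
    then show ?case using s d by (intro wp_Assign rest) simp_all
  next
    case 2
    then show ?case using s d by (intro rest) (simp_all split: if_splits)
  qed
qed

lemma wp_mainP:
  assumes s: "s 0 = g" and k: "k \<le> n"
  shows "wp N mainP (\<lambda>s'. \<exists>w B. round_inv k (s' 1) w B) s"
  unfolding mainP_def
proof (rule wp_Seq, rule wp_conseq[OF wp_initP[where s = s, OF s]], goal_cases)
  case (1 s1)
  have s1: "s1 0 = g" "s1 aDD 0 = 2 * d" using s 1 by (simp_all add: frameD)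
  show ?case
  proof (rule wp_For[where hi = k and I = "\<lambda>l s'. round_inv l (s' 1) (s' aW) (s' aBIG 0) \<and> s' aROW 0 = l * m"], goal_cases)
    case (2 s')
    then show ?case using s1 by (simp add: frameD)
  next
    case 4
    then show ?case using round_inv_0[OF k] 1(2) by simp
  next
    case (5 l s2)
    define w B where "w = s2 aW" and "B = s2 aBIG 0"
    have s2: "s2 0 = g" "s2 aW = w" "s2 aDD 0 = 2 * d" "s2 aBIG 0 = B"
      using s1 5(3) by (simp_all add: frameD w_def B_def)
    have R: "round_inv l (s2 1) w B" "s2 aROW 0 = l * m" using 5(4) by (simp_all add: w_def B_def)
    then have w: "support w = active" "sum w active < B" by (simp_all add: round_inv_def)
    show ?case
    proof (rule wp_Seq, rule wp_conseq[OF wp_growtreeP[where s = s2, OF s2 w]], goal_cases)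
      case (1 s3)
      have s3: "s3 0 = g" "s3 aROW 0 = l * m" "s3 1 = s2 1" "s3 aW = w" "s3 aBIG 0 = B"
        using s2 R 1(1) by (simp_all add: frameD)
      note tree = 1(2)
      show ?case
      proof (rule wp_Seq, rule wp_conseq[OF wp_emitP[where s = s3, OF s3(1,2) refl refl s3(4)]], goal_cases)
        case (1 s4)
        have s4: "s4 0 = g" "s4 aROW 0 = l * m" "s4 aBIG 0 = B"
          using s3 1(1) by (simp_all add: frameD)
        have "round_inv (Suc l) (s4 1) (s4 aW) (B + B)"
          by (rule round_inv_Suc[OF R(1), where T = "s3 aT" and F = "s3 aH"]) (use tree 1(2) s3 in auto)
        then show ?case using s4 by (intro wp_Seq wp_Assign) simp
      qed
    qed
  next
    case (6 s')
    then show ?case by blast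
  qed (use bounds in simp_all)
qed

lemma round_inv_load:
  assumes R: "round_inv k out w B"
  shows "real (card {i. i < k \<and> e \<in> tree_at out i}) \<le> 7 * log 2 (real n)"
proof (cases "e \<in> active")
  case True
  define c where "c = card {i. i < k \<and> e \<in> tree_at out i}"
  define y where "y = 4 * ln (real n) / real k"
  have y: "y \<ge> 0" using pos by (simp add: y_def)
  have "2 ^ c \<le> w e" using R True by (simp add: round_inv_def c_def)
  also have "w e \<le> sum w active" using True by (intro member_le_sum) auto
  finally have "real (2 ^ c) \<le> real (sum w active)" by (simp only: of_nat_le_iff)
  also have "\<dots> \<le> real n ^ 3 * (1 + y) ^ k"
    using R by (simp add: round_inv_def y_def)
  \<comment> \<open>\<open>1 + y \<le> exp y\<close>, and \<open>k * y = 4 * ln n\<close> cancels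
    \<open>k\<close>; so the load exponent is \<open>3 + 4 = 7\<close>.\<close>
  also have "\<dots> \<le> real n ^ 3 * exp y ^ k"
    using y exp_ge_add_one_self[of y] by (intro mult_left_mono power_mono) auto
  also have "exp y ^ k = exp (real k * y)" by (simp add: exp_of_nat_mult)
  also have "real k * y = real 4 * ln (real n)" using pos by (simp add: y_def)
  also have "exp (real 4 * ln (real n)) = real n ^ 4" using pos by (subst exp_of_nat_mult) simp
  also have "real n ^ 3 * real n ^ 4 = real n ^ 7" by (simp flip: power_add)
  finally have "2 ^ c \<le> n ^ 7" by (simp flip: of_nat_power)
  then have "real c \<le> log 2 (real (n ^ 7))" by (rule le_log2_of_power)
  also have "\<dots> = 7 * log 2 (real n)" using pos by (simp add: log_nat_power)
  finally show ?thesis by (simp add: c_def)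
next
  case False
  then have "{i. i < k \<and> e \<in> tree_at out i} = {}" using R by (auto simp: round_inv_def)
  moreover have "0 \<le> 7 * log 2 (real n)" using pos by simp
  ultimately show ?thesis by (simp only: card.empty of_nat_0)
qed

end

section \<open>Encoding of the input\<close>

lemma length_le_input_size: "length xs \<le> input_size xs"
  by (induction xs) (auto simp: input_size_def)

lemma length_encode_input: "length (encode_input D k n es) = 4 + 2 * length es"
proof -
  have "length (concat (map (\<lambda>(u, v). [u, v]) es)) = 2 * length es"
    by (induction es) auto
  then show ?thesis by (simp add: encode_input_def)
qed

lemma nth_concat_pairs:
  "e < length es \<Longrightarrow> concat (map (\<lambda>(u, v). [u, v]) es) ! (2 * e) = fst (es ! e) \<and>
     concat (map (\<lambda>(u, v). [u, v]) es) ! Suc (2 * e) = snd (es ! e)"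
proof (induction es arbitrary: e)
  case (Cons p es)
  then show ?case by (cases p; cases e) auto
qed simp

lemma initial_memory_encode:
  fixes D k n es
  defines "g \<equiv> initial_memory (encode_input D k n es) 0"
  shows "g 0 = D" "g 1 = k" "g 2 = n" "g 3 = length es"
    "e < length es \<Longrightarrow> src_of g e = fst (es ! e)" "e < length es \<Longrightarrow> dst_of g e = snd (es ! e)"
proof -
  let ?r = "concat (map (\<lambda>(u, v). [u, v]) es)"
  have g: "g i = (D # k # n # length es # ?r) ! i" if "i < 4 + 2 * length es" for i
    using that length_encode_input[of D k n es] by (simp add: g_def initial_memory_def encode_input_def)
  show "g 0 = D" "g 1 = k" "g 2 = n" "g 3 = length es"
    using g[of 0] g[of 1] g[of 2] g[of 3] by simp_all
  assume e: "e < length es"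
  show "src_of g e = fst (es ! e)" "dst_of g e = snd (es ! e)"
    using e g[of "4 + (e + e)"] g[of "5 + (e + e)"] nth_concat_pairs[OF e]
    by (simp_all add: src_of_def dst_of_def)
qed

text \<open>Because \<open>n\<close> is encoded in binary, loops over vertices are polynomial only
  through this bound. With two or more vertices each one lies on an edge, and an edge covers two;
  the 1 accounts for a single vertex without edges.\<close>

lemma kD_connected_vertices_le_edges:
  assumes "kD_connected (graph_of n es) k D" "k > 0"
  shows "n \<le> 2 * length es + 1"
proof (cases "n \<le> 1")
  case False
  let ?G = "graph_of n es"
  have "{..<n} \<subseteq> (\<Union>e\<in>{..<length es}. ends ?G e)"
  proof
    fix u assume u: "u \<in> {..<n}"
    define v where "v = (if u = 0 then 1 else 0 :: nat)"
    have "u \<in> verts ?G" "v \<in> verts ?G" "u \<noteq> v"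
      using u False by (auto simp: graph_of_def v_def)
    then obtain P where "link_system (ends ?G) (edges ?G) k (min D (card (verts ?G))) u v P"
      using kD_connected_link_system[OF assms(1), of u v] by (auto simp: graph_of_def)
    then have P: "joins (ends ?G) u (P 0) v" "set (P 0) \<subseteq> edges ?G"
      using assms(2) by (auto simp: link_system_def)
    then obtain e es' where "P 0 = e # es'" using \<open>u \<noteq> v\<close> by (cases "P 0") auto
    then show "u \<in> (\<Union>e\<in>{..<length es}. ends ?G e)"
      using P by (auto simp: graph_of_def)
  qed
  then have "card {..<n} \<le> card (\<Union>e\<in>{..<length es}. ends ?G e)"
    by (intro card_mono) (auto simp: graph_of_def)
  also have "\<dots> \<le> (\<Sum>e\<in>{..<length es}. card (ends ?G e))"
    by (intro card_UN_le) auto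
  also have "\<dots> \<le> (\<Sum>e\<in>{..<length es}. 2)"
    by (intro sum_mono) (auto simp: graph_of_def card_insert_if)
  finally show ?thesis by simp
qed simp

text \<open>The input lists both ends of every edge, so \<open>n \<le> 2 * m + 1 < X\<close>; the
  tables with up to \<open>2 * n\<close> layers explain the iteration bound
  \<open>2 * X\<close>.\<close>

lemma mainP_correct:
  assumes "k > 0" "n > 0" "k \<le> n" "valid_edge_list n es" "kD_connected (graph_of n es) k D"
    and X: "X = input_size (encode_input D k n es)"
  shows "wp (2 * X) mainP (\<lambda>s.
      (\<forall>l<k. is_spanning_tree (graph_of n es) (output_tree (length es) s l) \<and>
         real (graph_diameter (spanning_subgraph (graph_of n es) (output_tree (length es) s l))) \<le> 4 * real D * log 2 (real n)) \<and>
      (\<forall>e. real (card {l. l < k \<and> e \<in> output_tree (length es) s l}) \<le> 7 * log 2 (real n)))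
    (initial_memory (encode_input D k n es))"
proof -
  define s where "s = initial_memory (encode_input D k n es)"
  define g where "g = s 0"
  define en where "en = ends (graph_of n es)"
  define m where "m = length es"
  note init = initial_memory_encode[where D = D and k = k and n = n and es = es, folded s_def, folded g_def m_def]
  have valid: "fst (es ! e) < n \<and> snd (es ! e) < n \<and> fst (es ! e) \<noteq> snd (es ! e)" if "e < m" for e
    using assms(4) nth_mem[of e es] that unfolding valid_edge_list_def m_def by (auto simp: case_prod_beta)
  have en: "en e = {fst (es ! e), snd (es ! e)}" for e by (simp add: en_def graph_of_def)
  have size: "4 + 2 * m \<le> X"
    using length_le_input_size[of "encode_input D k n es"] by (simp add: X length_encode_input m_def)
  have n: "n \<le> 2 * m + 1" using kD_connected_vertices_le_edges[OF assms(5,1)] by (simp add: m_def)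
  interpret ram_input g en "2 * X"
  proof
    fix e assume "e < g 3"
    then have e: "e < m" using init by simp
    show "en e = {src_of g e, dst_of g e}" "src_of g e < g 2" "dst_of g e < g 2" "src_of g e \<noteq> dst_of g e"
      using valid[OF e] init(3) init(5,6)[OF e] en by auto
  qed (use init size n assms(3) in auto)
  interpret connected_input g en "2 * X" "min D n"
  proof
    fix u v assume uv: "u < g 2" "v < g 2" "u \<noteq> v"
    then have "\<exists>P. link_system (ends (graph_of n es)) (edges (graph_of n es)) k (min D (card (verts (graph_of n es)))) u v P"
      using init by (intro kD_connected_link_system assms(5)) (auto simp: graph_of_def)
    then obtain P where "link_system en {..<g 3} (g 1) (min D n) u v P"
      using init unfolding en_def by (auto simp: graph_of_def m_def)
    then show "\<exists>P. link_system en (active_edges en (g 3) (g 1)) (g 1) (min D n) u v P"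
      by (rule link_system_active)
  qed (use init assms in auto)
  have out: "output_tree (length es) t l = tree_at (t 1) l" for t l
    by (simp add: output_tree_def tree_at_def init m_def)
  have G: "graph = graph_of n es"
    using init by (simp add: graph_of_def en_def m_def)
  show ?thesis
    unfolding s_def[symmetric]
  proof (rule wp_conseq[OF wp_mainP[where s = s]], goal_cases)
    case (3 t)
    then obtain w B where R: "round_inv k (t 1) w B" using init by auto
    show ?case
    proof (intro conjI allI impI)
      fix l assume "l < k"
      then have tree: "good_tree (tree_at (t 1) l)" using R by (simp add: round_inv_def)
      then show "is_spanning_tree (graph_of n es) (output_tree (length es) t l)"
        unfolding out good_tree_def G by simp
      have "real (graph_diameter (spanning_subgraph (graph_of n es) (output_tree (length es) t l)))
          \<le> 4 * real (min D n) * log 2 (real n)"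
        using tree init(3) unfolding out good_tree_def G by simp
      also have "\<dots> \<le> 4 * real D * log 2 (real n)"
        using assms(2) by (intro mult_right_mono) auto
      finally show "real (graph_diameter (spanning_subgraph (graph_of n es) (output_tree (length es) t l)))
          \<le> 4 * real D * log 2 (real n)" .
    next
      fix e
      show "real (card {l. l < k \<and> e \<in> output_tree (length es) t l}) \<le> 7 * log 2 (real n)"
        using round_inv_load[of "t 1" w B e] R init unfolding out by simp
    qed
  qed (use init assms(3) g_def in auto)
qed

text \<open>The run is a point mass on a halted configuration, so both bounds hold surely, and the
  witnesses do not depend on \<open>c\<close>.\<close>

theorem theorem1p4:
  fixes c :: nat
  shows "\<exists>(P :: prog) (C :: real) (q :: nat poly).
    \<forall>(D :: nat) (k :: nat) (n :: nat) (es :: (nat \<times> nat) list).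
      D > 0 \<and> k > 0 \<and> n > 0 \<and> k \<le> n \<and> valid_edge_list n es \<and>
      kD_connected (graph_of n es) k D \<longrightarrow>
      (let xs = encode_input D k n es;
           R = run (poly q (input_size xs)) (P, initial_memory xs);
           G = graph_of n es;
           T = output_tree (length es)
       in (\<forall>(P', s) \<in> set_pmf R.
             P' = Skip \<and>
             (\<forall>l<k. is_spanning_tree G (T s l) \<and>
                    real (graph_diameter (spanning_subgraph G (T s l))) \<le> C * real D * ln (real n))) \<and>
          measure_pmf.prob R
            {(P', s). \<forall>e\<in>edges G. real (card {l. l < k \<and> e \<in> T s l}) \<le> C * ln (real n)}
            \<ge> 1 - 1 / real n ^ c)"
proof -
  obtain q where q: "\<And>N. cost N mainP = poly q N" using cost_poly[of mainP] by blast
  \<comment> \<open>7 is the larger of the constants 4 for the diameter and 7 for the load; the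
    division converts \<open>log 2\<close> to \<open>ln\<close>.\<close>
  define C where "C = 7 / ln (2 :: real)"
  show ?thesis
  proof (intro exI[of _ mainP] exI[of _ C] exI[of _ "pcompose q [:0, 2:]"] allI impI, goal_cases)
    case (1 D k n es)
    define X where "X = input_size (encode_input D k n es)"
    have cost: "poly (pcompose q [:0, 2:]) X = cost (2 * X) mainP"
      by (simp add: poly_pcompose q mult.commute)
    have "wp (2 * X) mainP (\<lambda>s.
        (\<forall>l<k. is_spanning_tree (graph_of n es) (output_tree (length es) s l) \<and>
           real (graph_diameter (spanning_subgraph (graph_of n es) (output_tree (length es) s l))) \<le> 4 * real D * log 2 (real n)) \<and>
        (\<forall>e. real (card {l. l < k \<and> e \<in> output_tree (length es) s l}) \<le> 7 * log 2 (real n)))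
      (initial_memory (encode_input D k n es))"
      using 1 by (intro mainP_correct) (simp_all add: X_def)
    then obtain s where s: "(\<forall>l<k. is_spanning_tree (graph_of n es) (output_tree (length es) s l) \<and>
           real (graph_diameter (spanning_subgraph (graph_of n es) (output_tree (length es) s l))) \<le> 4 * real D * log 2 (real n)) \<and>
        (\<forall>e. real (card {l. l < k \<and> e \<in> output_tree (length es) s l}) \<le> 7 * log 2 (real n))"
      and run: "\<forall>t\<ge>cost (2 * X) mainP. run t (mainP, initial_memory (encode_input D k n es)) = return_pmf (Skip, s)"
      by (blast dest: wp_run)
    have "4 * real D * log 2 (real n) \<le> 7 * real D * log 2 (real n)"
      using 1 by (intro mult_right_mono) auto
    also have "\<dots> = C * real D * ln (real n)" by (simp add: C_def log_def)
    finally have diam: "4 * real D * log 2 (real n) \<le> C * real D * ln (real n)" .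
    have load: "7 * log 2 (real n) = C * ln (real n)" by (simp add: C_def log_def)
    have trees: "is_spanning_tree (graph_of n es) (output_tree (length es) s l) \<and>
         real (graph_diameter (spanning_subgraph (graph_of n es) (output_tree (length es) s l))) \<le> C * real D * ln (real n)"
      if "l < k" for l
      using s that diam by (meson order_trans)
    have congestion: "real (card {l. l < k \<and> e \<in> output_tree (length es) s l}) \<le> C * ln (real n)" for e
      using s load by simp
    show ?case
      unfolding Let_def X_def[symmetric] cost run[rule_format, OF order_refl]
      using trees congestion by (auto simp: measure_return_pmf)
  qed
qed

end
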